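(* Let $k \ge 2$ be an integer, let $\psi:\mathbb N \to [0,1/2]$, and let $\kappa > 0$. Assume that $\psi$ is non-increasing, that $\psi(n) < n^{-\kappa}$ for all $n\in\mathbb N$, and that $\tilde\Psi_k^\times(N) = \sum_{n \le N} \psi(n)(\log n)^{k-1}$ is unbounded as $N\to\infty$. Let $\gamma_1,\ldots,\gamma_{k-1} \in \mathbb R$, and suppose that $(\alpha_1,\ldots,\alpha_{k-1}) \in \mathbb R^{k-1}$ has multiplicative exponent $w < \frac{k-1}{k-2}$, where $\frac{k-1}{k-2}$ is interpreted as $\infty$ when $k=2$. Then there is a constant $c>0$ depending only on $k$, $w$ and $\kappa$ such that, for almost all $\alpha_k \in \mathbb R$ (with respect to Lebesgue measure), we have \[ S^\times_{(\gamma_1,\ldots,\gamma_{k-1},0)}((\alpha_1,\ldots,\alpha_k),N,\psi) \ge c\, \tilde\Psi_k^\times(N) \] for all sufficiently large $N$.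
   Context: For $x \in \mathbb R$, $\|x\| = \inf_{m\in\mathbb Z}|x-m|$. For $N \in \mathbb N$ and $\boldsymbol\alpha, \boldsymbol\gamma \in \mathbb R^k$, $S^\times_{\boldsymbol\gamma}(\boldsymbol\alpha,N,\psi)$ denotes the number of $n \in \mathbb N$ with $n \le N$ and $\|n\alpha_1 - \gamma_1\| \cdots \|n\alpha_k - \gamma_k\| < \psi(n)$. The multiplicative exponent of $\boldsymbol\beta \in \mathbb R^d$ is $\omega^\times(\boldsymbol\beta) = \sup\{ w : \|n\beta_1\|\cdots\|n\beta_d\| < n^{-w} \text{ for infinitely many } n \in \mathbb N\}$. *)

theory Defs
  imports "HOL-Analysis.Analysis"
begin

(* The natural numbers of the source are the positive integers.  Points of R^d are
   functions nat => real of which only the coordinates 1..d are used, so that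
   the dimension can be quantified over inside a statement. *)

definition dist_int :: "real \<Rightarrow> real" where
  "dist_int x = (INF m::int. \<bar>x - of_int m\<bar>)"

definition mult_count ::
    "nat \<Rightarrow> (nat \<Rightarrow> real) \<Rightarrow> (nat \<Rightarrow> real) \<Rightarrow> nat \<Rightarrow> (nat \<Rightarrow> real) \<Rightarrow> nat" where
  "mult_count k \<gamma> \<alpha> N \<psi> =
     card {n\<in>{1..N}. (\<Prod>i=1..k. dist_int (real n * \<alpha> i - \<gamma> i)) < \<psi> n}"

(* The supremum is taken in the extended reals, since it may be infinite. *)
definition mult_exponent :: "nat \<Rightarrow> (nat \<Rightarrow> real) \<Rightarrow> ereal" where
  "mult_exponent d \<beta> =
     Sup {ereal w | w. infinite {n::nat. n \<ge> 1 \<and>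
            (\<Prod>i=1..d. dist_int (real n * \<beta> i)) < real n powr (- w)}}"

definition Psi_tilde :: "nat \<Rightarrow> (nat \<Rightarrow> real) \<Rightarrow> nat \<Rightarrow> real" where
  "Psi_tilde k \<psi> N = (\<Sum>n=1..N. \<psi> n * ln (real n) ^ (k - 1))"

definition exponent_bound :: "nat \<Rightarrow> ereal" where
  "exponent_bound k = (if k = 2 then \<infinity> else ereal ((real k - 1) / (real k - 2)))"

end

theory Submission
  imports Defs
begin

text \<open>Write \<open>d = k - 1\<close>. The bound on the multiplicative exponent gives, by Khinchin's transference principle,
  a polynomial lower bound for the distances to the integers of the linear forms in
  \<open>\<alpha>\<^sub>1, \<dots>, \<alpha>\<^sub>d\<close>. On each dyadic block the weights \<open>1 / \<parallel>n \<alpha>\<^sub>i - \<gamma>\<^sub>i\<parallel>\<close> are minorised by sums of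
  Fejer kernels of small degree; expanding these and summing geometric series, one obtains the
  expected sums of the weights over the block and over its multiples of any integer that is not too large.
  This produces radii \<open>\<Phi> n\<close> such that \<open>\<parallel>n x\<parallel> < \<Phi> n\<close> implies the multiplicative inequality.
  For the count in \<open>x\<close> only those fractions \<open>a / n\<close> are used for which \<open>gcd a n \<le> D\<close>.
  For large \<open>D\<close> they retain almost all of the measure, while coinciding fractions are so few that the variance is
  \<open>O(D V + V\<^sup>2 / D)\<close>, where \<open>V\<close> is the sum of the radii. Letting \<open>D\<close> grow slowly with \<open>V\<close>, Chebyshev's
  inequality and the Borel-Cantelli lemma give the result, without the Koukoulopoulos-Maynard theorem.\<close>

section \<open>Distance to the nearest integer\<close>

text \<open>The bound has to be uniform: c may depend on k, w and \<kappa>, but not on \<alpha>,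
  \<gamma> or \<psi>. So only an exponent \<open>A\<close>, determined by k and w, enters the
  weights. The constant factor in the bound for linear forms does depend on \<alpha>, but it only
  decides from which block on the estimates hold; the earlier blocks are absorbed because
  \<open>Psi_tilde\<close> is unbounded.

  The weights on block j are built with J = j div s instead of j. This costs a factor of order s^d
  in c and makes room for three demands, one for each lower bound on s: exponential sums over
  multiples of q must be small against 2^j / q, the trivial bound must be harmless for large q, and
  the radii must not exceed 1/2.

  The overlap estimate for distinct fractions has the constant of exact independence. So the main
  terms of the second moment cancel completely, and Chebyshev's inequality leaves a bound that tends
  to 0 instead of a mere positive proportion.\<close>

lemma dist_int_eq_round: "dist_int x = \<bar>x - of_int (round x)\<bar>"
  unfolding dist_int_def
proof (rule antisym)
  show "(INF m::int. \<bar>x - of_int m\<bar>) \<le> \<bar>x - of_int (round x)\<bar>"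
    by (rule cINF_lower) (auto intro!: bdd_belowI[of _ 0])
  show "\<bar>x - of_int (round x)\<bar> \<le> (INF m::int. \<bar>x - of_int m\<bar>)"
    by (rule cINF_greatest) (auto simp: round_diff_minimal)
qed

lemma dist_int_le: "dist_int x \<le> \<bar>x - of_int m\<bar>"
  by (simp add: dist_int_eq_round round_diff_minimal)

lemma dist_int_nonneg [simp]: "0 \<le> dist_int x"
  by (simp add: dist_int_eq_round)

lemma dist_int_le_half: "dist_int x \<le> 1 / 2"
  unfolding dist_int_eq_round using of_int_round_abs_le[of x] by (simp add: abs_minus_commute)

lemma dist_int_add_int [simp]: "dist_int (x + of_int m) = dist_int x"
proof (rule antisym)
  show "dist_int (x + of_int m) \<le> dist_int x"
    using dist_int_le[of "x + of_int m" "round x + m"] by (simp add: dist_int_eq_round[of x])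
  show "dist_int x \<le> dist_int (x + of_int m)"
    using dist_int_le[of x "round (x + of_int m) - m"]
    by (simp add: dist_int_eq_round[of "x + of_int m"] algebra_simps)
qed

lemma dist_int_eq_abs_obtain:
  obtains m :: int and y where "x = y + of_int m" "\<bar>y\<bar> = dist_int x" "\<bar>y\<bar> \<le> 1 / 2"
  using that[of "x - of_int (round x)" "round x"] dist_int_le_half[of x] by (simp add: dist_int_eq_round)

abbreviation cisn :: "real \<Rightarrow> complex" where
  "cisn x \<equiv> cis (2 * pi * x)"

lemma cisn_add: "cisn (x + y) = cisn x * cisn y"
  by (simp add: cis_mult ring_distribs)

lemma cisn_of_int [simp]: "cisn (of_int m) = 1"
  by (simp add: cis_multiple_2pi)

lemma cisn_mult_nat: "cisn (real n * x) = cisn x ^ n"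
  by (subst Complex.DeMoivre) (simp add: algebra_simps)

text \<open>For x = pi y in [0, 1.6] the Taylor error x^3 / 6 is at most x / 2, because 1.6^2 < 3;
  hence sin x >= x / 2 >= y.\<close>

lemma abs_sin_pi_ge:
  assumes "\<bar>y\<bar> \<le> 1 / 2"
  shows "\<bar>y\<bar> \<le> \<bar>sin (pi * y)\<bar>"
proof -
  have *: "y \<le> sin (pi * y)" if y: "0 \<le> y" "y \<le> 1 / 2" for y :: real
  proof -
    define x where "x = pi * y"
    have pi: "3 < pi" "pi < 3.2" using pi_approx by auto
    have "x \<le> pi * (1/2)" unfolding x_def using y by (intro mult_left_mono) auto
    hence x: "0 \<le> x" "x \<le> 1.6" using pi y by (auto simp: x_def[symmetric]) (simp add: x_def)
    have "\<bar>sin x - (\<Sum>m<3. sin_coeff m * x ^ m)\<bar> \<le> inverse (fact 3) * \<bar>x\<bar> ^ 3"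
      by (rule Maclaurin_sin_bound)
    hence "\<bar>sin x - x\<bar> \<le> x ^ 3 / 6"
      using x by (simp add: eval_nat_numeral sin_coeff_def field_simps)
    moreover have "x ^ 3 \<le> 3 * x"
    proof -
      have "x ^ 2 \<le> 1.6 ^ 2" using x by (intro power_mono) auto
      hence "x * x ^ 2 \<le> x * 3" using x by (intro mult_left_mono) (auto simp: power2_eq_square)
      thus ?thesis by (simp add: eval_nat_numeral algebra_simps)
    qed
    ultimately have "x / 2 \<le> sin x" by linarith
    moreover have "y \<le> x / 2" unfolding x_def using mult_right_mono[of 3 pi y] pi y by simp
    ultimately show ?thesis by (simp add: x_def)
  qed
  show ?thesis
  proof (cases "y \<ge> 0")
    case True thus ?thesis using *[of y] assms by auto
  next
    case False thus ?thesis using *[of "-y"] assms by auto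
  qed
qed

lemma norm_one_minus_cisn: "dist_int x \<le> norm (1 - cisn x) / 2"
proof -
  obtain m y where y: "x = y + of_int m" "\<bar>y\<bar> = dist_int x" "\<bar>y\<bar> \<le> 1 / 2"
    by (rule dist_int_eq_abs_obtain)
  have "cisn x = cisn y" using y(1) by (simp add: cisn_add)
  have "norm (1 - cisn y) ^ 2 = (1 - cos (2*pi*y))^2 + sin (2*pi*y) ^ 2"
    by (simp add: cmod_power2)
  also have "\<dots> = 2 - 2 * cos (2 * (pi*y))"
    using sin_cos_squared_add[of "2*pi*y"] by (simp add: power2_eq_square algebra_simps)
  also have "\<dots> = (2 * \<bar>sin (pi * y)\<bar>) ^ 2"
    by (subst cos_double_sin) (simp add: power_mult_distrib)
  finally have "norm (1 - cisn y) = 2 * \<bar>sin (pi * y)\<bar>"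
    by (rule power2_eq_imp_eq) auto
  thus ?thesis using abs_sin_pi_ge[OF y(3)] y(2) \<open>cisn x = cisn y\<close> by simp
qed

text \<open>In the closed form of the geometric sum the numerator has norm at most 2 and the
  denominator norm at least 2 \<open>dist_int x\<close>. The bound is independent of the length of
  the interval; every error term for the weights goes back to it.\<close>

lemma norm_sum_cisn_le:
  assumes "dist_int x > 0"
  shows "norm (\<Sum>n\<in>{a..<b}. cisn (real n * x)) \<le> 1 / dist_int x"
proof (cases "a \<le> b")
  case True
  have ne: "cisn x \<noteq> 1"
    using norm_one_minus_cisn[of x] assms by auto
  have "(\<Sum>n\<in>{a..<b}. cisn (real n * x)) = (\<Sum>n\<in>{a..<b}. cisn x ^ n)"
    by (simp only: cisn_mult_nat)
  also have "\<dots> = (cisn x ^ b - cisn x ^ a) / (cisn x - 1)"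
    using True ne by (simp add: geometric_sum sum_diff_nat atLeast0LessThan
        sum_diff_nat_ivl[of 0 a b "\<lambda>n. cisn x ^ n", symmetric] diff_divide_distrib)
  also have "norm \<dots> \<le> 2 / norm (1 - cisn x)"
  proof -
    have "norm (cisn x ^ b - cisn x ^ a) \<le> 2"
      by (rule order.trans[OF norm_triangle_ineq4]) (simp add: norm_power)
    thus ?thesis by (simp add: norm_divide divide_right_mono norm_minus_commute)
  qed
  also have "\<dots> \<le> 1 / dist_int x"
    using norm_one_minus_cisn[of x] assms ne by (simp add: field_simps)
  finally show ?thesis .
qed simp

section \<open>Transference\<close>

lemma dist_int_add_le: "dist_int (x + y) \<le> dist_int x + dist_int y"
  using dist_int_le[of "x + y" "round x + round y"] by (simp add: dist_int_eq_round[of x] dist_int_eq_round[of y])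

lemma dist_int_minus [simp]: "dist_int (- x) = dist_int x"
proof -
  have "dist_int (- x) \<le> dist_int x" for x
    using dist_int_le[of "- x" "- round x"] by (simp add: dist_int_eq_round[of x])
  from this[of x] this[of "- x"] show ?thesis by simp
qed

lemma dist_int_sum_le: "dist_int (\<Sum>i\<in>I. f i) \<le> (\<Sum>i\<in>I. dist_int (f i))"
proof (induction I rule: infinite_finite_induct)
  case (insert i I)
  thus ?case using dist_int_add_le[of "f i" "sum f I"] by simp
qed (use dist_int_le[of 0 0] in auto)

lemma dist_int_mult_int_le: "dist_int (of_int k * x) \<le> \<bar>of_int k\<bar> * dist_int x"
proof -
  have "dist_int (of_int k * x) \<le> \<bar>of_int k * x - of_int (k * round x)\<bar>"
    by (rule dist_int_le)
  also have "\<dots> = \<bar>of_int k * (x - of_int (round x))\<bar>" by (simp add: algebra_simps)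
  finally show ?thesis by (simp add: dist_int_eq_round[of x] abs_mult)
qed

text \<open>Khinchin's transference principle: a very good rational linear relation among the coordinates of \<open>\<alpha>\<close>
  would yield, through Dirichlet's theorem in \<open>d - 1\<close> of the coordinates, simultaneous approximations
  contradicting the bound on the multiplicative exponent.\<close>

lemma simultaneous_approx_of_linear_form:
  fixes d Q :: nat and h :: "nat \<Rightarrow> int" and \<alpha> :: "nat \<Rightarrow> real"
  assumes Q: "Q > 0" and i0: "i0 \<in> {1..d}" "h i0 \<noteq> 0"
    and max: "\<And>i. i \<in> {1..d} \<Longrightarrow> \<bar>h i\<bar> \<le> \<bar>h i0\<bar>"
    and small: "dist_int (\<Sum>i=1..d. of_int (h i) * \<alpha> i) \<le> 1 / real Q ^ d"
  obtains n :: nat where "n \<ge> 1" "real n \<le> \<bar>h i0\<bar> * real Q ^ (d - 1)"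
    "\<And>i. i \<in> {1..d} \<Longrightarrow> dist_int (real n * \<alpha> i) \<le> real d * real_of_int \<bar>h i0\<bar> / Q"
proof -
  \<comment> \<open>\<open>e\<close> enumerates {1..d} without \<open>i0\<close> by 0, ..., d - 2,
    the index range of Dirichlet's theorem.\<close>
  define e where "e = (\<lambda>i. if i + 1 < i0 then i + 1 else i + 2)"
  obtain q p where q: "0 < q" "q \<le> int (Q ^ (d - 1))"
    and p: "\<And>i. i < d - 1 \<Longrightarrow> \<bar>of_int q * \<alpha> (e i) - of_int (p i)\<bar> < 1 / Q"
    by (rule Dirichlet_approx_simult[OF Q, where \<theta> = "\<lambda>i. \<alpha> (e i)" and n = "d - 1"]) blast
  have q_le: "real_of_int q \<le> real Q ^ (d - 1)"
    using q(2) by (metis of_int_le_iff of_int_of_nat_eq of_nat_power)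
  have dq: "dist_int (of_int q * \<alpha> i) \<le> 1 / Q" if i: "i \<in> {1..d}" "i \<noteq> i0" for i
  proof -
    obtain j where j: "j < d - 1" "e j = i"
    proof (cases "i < i0")
      case True
      show ?thesis by (rule that[of "i - 1"]) (use True i i0 in \<open>auto simp: e_def\<close>)
    next
      case False
      show ?thesis by (rule that[of "i - 2"]) (use False i i0 in \<open>auto simp: e_def\<close>)
    qed
    show ?thesis using p[OF j(1)] dist_int_le[of "of_int q * \<alpha> i" "p j"] by (simp add: j(2))
  qed
  define H where "H = real_of_int \<bar>h i0\<bar>"
  have H: "H \<ge> 1" using i0(2) by (simp add: H_def)
  \<comment> \<open>Multiplying q by |h i0| lets the relation itself handle the coordinate
    \<open>i0\<close>: h i0 q \<alpha> i0 equals q times the linear form minus terms in the other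
    coordinates, which q already approximates.\<close>
  define n where "n = nat (\<bar>h i0\<bar> * q)"
  have n_pos: "\<bar>h i0\<bar> * q > 0" using i0(2) q by simp
  have n: "real n = H * of_int q" using n_pos by (simp add: n_def H_def)
  have one: "1 / Q \<le> H / Q" using H Q by (intro divide_right_mono) auto
  have "dist_int (real n * \<alpha> i) \<le> d * H / Q" if i: "i \<in> {1..d}" for i
  proof (cases "i = i0")
    case False
    have "dist_int (real n * \<alpha> i) = dist_int (of_int \<bar>h i0\<bar> * (of_int q * \<alpha> i))"
      by (simp add: n H_def mult.assoc)
    also have "\<dots> \<le> \<bar>of_int \<bar>h i0\<bar>\<bar> * dist_int (of_int q * \<alpha> i)" by (rule dist_int_mult_int_le)
    also have "\<dots> \<le> H * (1 / Q)" using dq[OF i False] H by (intro mult_mono) (auto simp: H_def)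
    also have "\<dots> \<le> d * H / Q" using i H Q by (simp add: divide_right_mono)
    finally show ?thesis .
  next
    case True
    let ?L = "\<Sum>i=1..d. of_int (h i) * \<alpha> i"
    let ?R = "\<Sum>i\<in>{1..d} - {i0}. of_int (h i) * (of_int q * \<alpha> i)"
    have "of_int q * ?L = of_int (h i0) * (of_int q * \<alpha> i0) + ?R"
      using i0 by (simp add: sum.remove[of _ i0] sum_distrib_left algebra_simps)
    hence eq: "of_int (h i0) * (of_int q * \<alpha> i0) = of_int q * ?L + - ?R" by simp
    have "dist_int (real n * \<alpha> i) = dist_int (of_int (h i0) * (of_int q * \<alpha> i0))"
      using dist_int_minus[of "of_int (h i0) * (of_int q * \<alpha> i0)"]
      by (cases "h i0 \<ge> 0") (simp_all add: True n H_def mult.assoc abs_if)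
    also have "\<dots> \<le> dist_int (of_int q * ?L) + dist_int ?R"
      unfolding eq by (rule order.trans[OF dist_int_add_le]) simp
    also have "dist_int (of_int q * ?L) \<le> \<bar>of_int q\<bar> * dist_int ?L" by (rule dist_int_mult_int_le)
    also have "\<dots> \<le> real Q ^ (d - 1) * (1 / real Q ^ d)"
      using small q q_le by (intro mult_mono) auto
    also have "\<dots> = 1 / Q" using i0 Q by (cases d) auto
    also note one
    also have "dist_int ?R \<le> (\<Sum>i\<in>{1..d} - {i0}. dist_int (of_int (h i) * (of_int q * \<alpha> i)))"
      by (rule dist_int_sum_le)
    also have "\<dots> \<le> (\<Sum>i\<in>{1..d} - {i0}. H * (1 / Q))"
    proof (intro sum_mono)
      fix i assume i: "i \<in> {1..d} - {i0}"
      have "dist_int (of_int (h i) * (of_int q * \<alpha> i)) \<le> \<bar>of_int (h i)\<bar> * dist_int (of_int q * \<alpha> i)"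
        by (rule dist_int_mult_int_le)
      also have "\<dots> \<le> H * (1 / Q)"
      proof (intro mult_mono)
        show "\<bar>real_of_int (h i)\<bar> \<le> H" using max[of i] i unfolding H_def of_int_abs[symmetric] of_int_le_iff by simp
      qed (use dq[of i] i H in auto)
      finally show "dist_int (of_int (h i) * (of_int q * \<alpha> i)) \<le> H * (1 / Q)" .
    qed
    also have "\<dots> = (d - 1) * (H / Q)" using i0 by simp
    also have "H / Q + (d - 1) * (H / Q) = d * H / Q"
      using i0 by (cases d) (auto simp: algebra_simps add_divide_distrib)
    finally show ?thesis by simp
  qed
  moreover have "real n \<le> H * real Q ^ (d - 1)" using q_le H by (simp add: n mult_left_mono)
  moreover have "n \<ge> 1" using n_pos by (simp add: n_def)
  ultimately show ?thesis using that[of n] by (simp add: H_def)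
qed

text \<open>\<open>A\<close> and \<open>c\<close> have different dependences: one \<open>A\<close>
  will serve all \<alpha> with the given bound on the exponent, while \<open>c\<close> depends on
  \<alpha>. Since \<open>c > 0\<close>, the inequality also yields that the distance is
  positive.\<close>

definition linear_form_bounded :: "nat \<Rightarrow> (nat \<Rightarrow> real) \<Rightarrow> nat \<Rightarrow> real \<Rightarrow> bool" where
  "linear_form_bounded d \<alpha> A c \<longleftrightarrow> c > 0 \<and> (\<forall>(h :: nat \<Rightarrow> int) (H :: nat).
        (\<exists>i\<in>{1..d}. h i \<noteq> 0) \<longrightarrow> (\<forall>i\<in>{1..d}. \<bar>h i\<bar> \<le> int H) \<longrightarrow>
        c \<le> dist_int (\<Sum>i=1..d. of_int (h i) * \<alpha> i) * real H ^ A)"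

lemma linear_form_boundedD:
  assumes "linear_form_bounded d \<alpha> A c" "\<exists>i\<in>{1..d}. h i \<noteq> 0" "\<And>i. i \<in> {1..d} \<Longrightarrow> \<bar>h i\<bar> \<le> int H"
  shows "c \<le> dist_int (\<Sum>i=1..d. of_int (h i) * \<alpha> i) * real H ^ A"
  using assms unfolding linear_form_bounded_def by simp

text \<open>\<open>A\<close> is obtained before \<alpha> and depends on d and w only. Let G be the
  largest |h i|. A relation of quality Q^(-d) gives, by transference, some n <= G Q^(d - 1) whose
  product is at most (d G / Q)^d. Comparison with c n^(-w) yields Q^\<theta> <= (d^d / c) G^(d + w),
  with \<theta> > 0 by the hypothesis on w. This fails once Q exceeds K G^b, where b = (d + w) /
  \<theta>.\<close>

lemma linear_form_bound:
  fixes d :: nat and w :: real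
  assumes d: "d \<ge> 1" and w: "w > 0" "(real d - 1) * w < real d"
  obtains A :: nat where
    "\<And>\<alpha>. finite {n::nat. n \<ge> 1 \<and> (\<Prod>i=1..d. dist_int (real n * \<alpha> i)) < real n powr (- w)} \<Longrightarrow>
      \<exists>c. linear_form_bounded d \<alpha> A c"
proof -
  define \<theta> where "\<theta> = real d - (real d - 1) * w"
  have \<theta>: "\<theta> > 0" using w by (simp add: \<theta>_def)
  define b where "b = (real d + w) / \<theta>"
  have b: "b > 0" using d w \<theta> by (simp add: b_def)
  define A where "A = nat \<lceil>b * d\<rceil>"
  have A: "real A \<ge> b * d" unfolding A_def by linarith
  have "\<exists>c. linear_form_bounded d \<alpha> A c"
    if fin: "finite {n::nat. n \<ge> 1 \<and> (\<Prod>i=1..d. dist_int (real n * \<alpha> i)) < real n powr (- w)}" (is "finite ?S")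
    for \<alpha>
  proof -
    let ?P = "\<lambda>n::nat. \<Prod>i=1..d. dist_int (real n * \<alpha> i)"
    \<comment> \<open>A product vanishing at n vanishes at all multiples of n as well, which would
      make the exceptional set infinite.\<close>
    have pos: "?P n > 0" if n: "n \<ge> 1" for n
    proof (rule ccontr)
      assume "\<not> ?P n > 0"
      hence "\<exists>i\<in>{1..d}. \<not> dist_int (real n * \<alpha> i) > 0"
        using prod_pos[of "{1..d}" "\<lambda>i. dist_int (real n * \<alpha> i)"] by blast
      then obtain i where i: "i \<in> {1..d}" "dist_int (real n * \<alpha> i) = 0"
        by (metis dist_int_nonneg less_eq_real_def)
      have "(\<lambda>k. k * n) ` {1..} \<subseteq> ?S"
      proof (rule image_subsetI)
        fix k :: nat assume k: "k \<in> {1..}"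
        have "dist_int (real (k * n) * \<alpha> i) \<le> \<bar>of_int (int k)\<bar> * dist_int (real n * \<alpha> i)"
          using dist_int_mult_int_le[of "int k" "real n * \<alpha> i"] by (simp add: mult.assoc)
        hence "dist_int (real (k * n) * \<alpha> i) \<le> 0" by (simp only: i(2) mult_zero_right)
        hence "dist_int (real (k * n) * \<alpha> i) = 0" by (intro antisym dist_int_nonneg)
        hence P0: "?P (k * n) = 0" using i(1) by (intro prod_zero) auto
        show "k * n \<in> ?S"
          unfolding mem_Collect_eq P0 using k n by simp
      qed
      moreover have "infinite ((\<lambda>k. k * n) ` {1..})"
        using n by (subst finite_image_iff) (auto simp: inj_on_def infinite_Ici)
      ultimately show False using fin finite_subset by blast
    qed
    \<comment> \<open>The minimum over the finitely many exceptional n, with 1 inserted for the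
      others, makes the lower bound valid for all n >= 1.\<close>
    define c where "c = Min (insert 1 (?P ` ?S))"
    have c: "0 < c" "c \<le> 1"
      using fin pos by (auto simp: c_def)
    have c_le: "c * real n powr (- w) \<le> ?P n" if n: "n \<ge> 1" for n
    proof (cases "n \<in> ?S")
      case True
      have "c \<le> ?P n" using True fin by (auto simp: c_def intro!: Min_le)
      moreover have "c * real n powr (- w) \<le> c * 1"
        using powr_mono[of "- w" 0 "real n"] n w c by (intro mult_left_mono) auto
      ultimately show ?thesis by simp
    next
      case False
      hence "real n powr (- w) \<le> ?P n" using n by simp
      moreover have "c * real n powr (- w) \<le> 1 * real n powr (- w)" using c by (intro mult_right_mono) auto
      ultimately show ?thesis by simp
    qed
    define K where "K = (real d ^ d / c) powr (1 / \<theta>)"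
    have K: "K > 0" using c d by (simp add: K_def)
    define c0 where "c0 = 1 / (K + 1) ^ d"
    have c0: "c0 > 0" using K by (simp add: c0_def)
    have "c0 \<le> dist_int (\<Sum>i=1..d. of_int (h i) * \<alpha> i) * real H ^ A"
      if h: "\<exists>i\<in>{1..d}. h i \<noteq> 0" "\<forall>i\<in>{1..d}. \<bar>h i\<bar> \<le> int H" for h :: "nat \<Rightarrow> int" and H :: nat
    proof -
      obtain i0 where i0: "i0 \<in> {1..d}" "\<And>i. i \<in> {1..d} \<Longrightarrow> \<bar>h i\<bar> \<le> \<bar>h i0\<bar>"
      proof -
        let ?M = "(\<lambda>i. \<bar>h i\<bar>) ` {1..d}"
        have "Max ?M \<in> ?M" using d by (intro Max_in) auto
        then obtain i0 where "i0 \<in> {1..d}" "Max ?M = \<bar>h i0\<bar>" by auto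
        moreover have "\<bar>h i\<bar> \<le> Max ?M" if "i \<in> {1..d}" for i using that by (intro Max_ge) auto
        ultimately show ?thesis using that by metis
      qed
      have hi0: "h i0 \<noteq> 0" using h(1) i0(2) by fastforce
      define G where "G = real_of_int \<bar>h i0\<bar>"
      have G: "1 \<le> G" "G \<le> H" using hi0 h(2) i0 unfolding G_def by (simp, fastforce)
      \<comment> \<open>An integer just above K G^b. As G^b >= 1, the added 1 costs only the passage
        from K to K + 1.\<close>
      define Q where "Q = nat \<lfloor>K * G powr b\<rfloor> + 1"
      have KG: "K * G powr b \<ge> 0" using K by simp
      have Q: "Q > 0" "real Q > K * G powr b" using KG unfolding Q_def by (simp, linarith)
      have "real Q \<le> K * G powr b + 1" using KG unfolding Q_def by linarith
      also have "1 \<le> G powr b" using G b by (simp add: ge_one_powr_ge_zero)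
      finally have Q_le: "real Q \<le> (K + 1) * G powr b" by (simp add: algebra_simps)
      have big: "dist_int (\<Sum>i=1..d. of_int (h i) * \<alpha> i) > 1 / real Q ^ d"
      proof (rule ccontr)
        assume "\<not> ?thesis"
        hence le: "dist_int (\<Sum>i=1..d. of_int (h i) * \<alpha> i) \<le> 1 / real Q ^ d" by simp
        obtain n where n: "n \<ge> 1" "real n \<le> G * real Q ^ (d - 1)"
          "\<And>i. i \<in> {1..d} \<Longrightarrow> dist_int (real n * \<alpha> i) \<le> d * G / Q"
          using simultaneous_approx_of_linear_form[where h=h and \<alpha>=\<alpha>, OF Q(1) i0(1) hi0 i0(2) le] unfolding G_def by auto
        have "c * (G * real Q ^ (d - 1)) powr (- w) \<le> c * real n powr (- w)"
          using c w n by (intro mult_left_mono powr_mono2') auto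
        also have "\<dots> \<le> ?P n" by (rule c_le[OF n(1)])
        also have "\<dots> \<le> (\<Prod>i=1..d. d * G / Q)" using n(3) by (intro prod_mono) auto
        also have "\<dots> = (d * G / Q) ^ d" by simp
        finally have "c * (G * real Q ^ (d - 1)) powr (- w) \<le> (d * G / Q) ^ d" .
        moreover have "(G * real Q ^ (d - 1)) powr (- w) = G powr (- w) * real Q powr (- ((real d - 1) * w))"
          using G Q d by (simp add: powr_mult powr_realpow[symmetric] powr_powr of_nat_diff)
        moreover have "(d * G / Q) ^ d = real d ^ d * G powr d * real Q powr (- real d)"
          using G Q by (simp add: power_divide power_mult_distrib powr_realpow powr_minus field_simps)
        ultimately have ineq: "c * (G powr (- w) * real Q powr (- ((real d - 1) * w)))
           \<le> real d ^ d * G powr d * real Q powr (- real d)" by simp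
        have "real Q powr \<theta> = (c * (G powr (- w) * real Q powr (- ((real d - 1) * w)))) * (G powr w * real Q powr d) / c"
          using c G Q by (simp add: \<theta>_def powr_add[symmetric] powr_diff powr_minus field_simps)
        also have "\<dots> \<le> (real d ^ d * G powr d * real Q powr (- real d)) * (G powr w * real Q powr d) / c"
          using c by (intro divide_right_mono mult_right_mono ineq) auto
        also have "\<dots> = real d ^ d / c * G powr (d + w)"
          using c G Q by (simp add: powr_add powr_minus field_simps)
        finally have "(real Q powr \<theta>) powr (1 / \<theta>) \<le> (real d ^ d / c * G powr (d + w)) powr (1 / \<theta>)"
          using \<theta> by (intro powr_mono2) auto
        also have "\<dots> = K * G powr b"
          using c G d by (subst powr_mult) (auto simp: powr_powr K_def b_def)
        finally show False using Q \<theta> by (simp add: powr_powr)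
      qed
      have "c0 = (G powr b) ^ d * (1 / ((K + 1) * G powr b) ^ d)"
        using G K by (simp add: c0_def power_mult_distrib)
      also have "\<dots> \<le> G ^ A * (1 / real Q ^ d)"
      proof (intro mult_mono divide_left_mono power_mono Q_le)
        have "(G powr b) ^ d = G powr (b * d)" using G by (simp add: powr_realpow[symmetric] powr_powr)
        also have "\<dots> \<le> G powr A" using G A by (intro powr_mono) auto
        finally show "(G powr b) ^ d \<le> G ^ A" using G by (simp add: powr_realpow)
      qed (use G K Q in auto)
      also have "\<dots> \<le> real H ^ A * dist_int (\<Sum>i=1..d. of_int (h i) * \<alpha> i)"
        using big G by (intro mult_mono power_mono) auto
      finally show ?thesis by (simp add: mult.commute)
    qed
    thus ?thesis unfolding linear_form_bounded_def using c0 by blast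
  qed
  thus ?thesis using that by blast
qed

section \<open>Fejer kernels\<close>

definition fejer :: "nat \<Rightarrow> real \<Rightarrow> real" where
  "fejer M x = (norm (\<Sum>l<M. cisn (real l * x)))\<^sup>2 / M"

text \<open>A nonnegative trigonometric polynomial of degree less than \<open>2 ^ J\<close> and mean \<open>J\<close> that is bounded by a
  multiple of \<open>1 / dist_int x\<close>.\<close>

definition fejer_sum :: "nat \<Rightarrow> real \<Rightarrow> real" where
  "fejer_sum J x = (\<Sum>i<J. fejer (2 ^ i) x)"

lemma fejer_nonneg [simp]: "0 \<le> fejer M x"
  by (simp add: fejer_def)

lemma fejer_sum_nonneg [simp]: "0 \<le> fejer_sum J x"
  by (simp add: fejer_sum_def sum_nonneg)

lemma fejer_le: "fejer M x \<le> M"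
proof -
  have "norm (\<Sum>l<M. cisn (real l * x)) \<le> M"
    by (rule order.trans[OF norm_sum]) simp
  hence "(norm (\<Sum>l<M. cisn (real l * x)))\<^sup>2 \<le> (real M)\<^sup>2" by (intro power_mono) auto
  thus ?thesis by (cases "M = 0") (auto simp: fejer_def power2_eq_square divide_simps)
qed

lemma fejer_le_dist_int:
  assumes "dist_int x > 0"
  shows "fejer M x \<le> 1 / (M * (dist_int x)\<^sup>2)"
proof -
  have "(norm (\<Sum>l<M. cisn (real l * x)))\<^sup>2 \<le> (1 / dist_int x)\<^sup>2"
    using norm_sum_cisn_le[OF assms, of 0 M] by (intro power_mono) (auto simp: atLeast0LessThan)
  hence "fejer M x \<le> (1 / dist_int x)\<^sup>2 / M"
    unfolding fejer_def by (rule divide_right_mono) simp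
  thus ?thesis by (simp add: power_divide mult.commute)
qed

lemma fejer_sum_le: "fejer_sum J x \<le> 2 ^ J"
proof -
  have "fejer_sum J x \<le> (\<Sum>i<J. 2 ^ i)"
    unfolding fejer_sum_def using fejer_le[of "2 ^ _"] by (intro sum_mono) simp
  also have "\<dots> \<le> (2 :: real) ^ J" by (induction J) auto
  finally show ?thesis .
qed

text \<open>With \<open>y = 2 ^ i * dist_int x\<close>, the \<open>i\<close>-th summand times \<open>dist_int x\<close> is at most \<open>min y (1 / y)\<close>, which is
  dominated by six times the increment from \<open>y\<close> to \<open>2 * y\<close> of \<open>y / (1 + y)\<close>.\<close>

lemma fejer_sum_mult_dist_int_le: "fejer_sum J x * dist_int x \<le> 6"
proof (cases "dist_int x = 0")
  case False
  define \<delta> where "\<delta> = dist_int x"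
  have \<delta>: "\<delta> > 0" using False dist_int_nonneg[of x] unfolding \<delta>_def by linarith
  define T where "T = (\<lambda>y::real. 1 - 1 / (1 + y))"
  have step: "fejer (2 ^ i) x * \<delta> \<le> 6 * (T (2 ^ Suc i * \<delta>) - T (2 ^ i * \<delta>))" for i
  proof -
    define y where "y = 2 ^ i * \<delta>"
    have y: "y > 0" using \<delta> by (simp add: y_def)
    have "fejer (2 ^ i) x * \<delta> \<le> 2 ^ i * \<delta>"
      using fejer_le[of "2 ^ i" x] \<delta> by (intro mult_right_mono) auto
    hence 1: "fejer (2 ^ i) x * \<delta> \<le> y" by (simp add: y_def)
    have "fejer (2 ^ i) x * \<delta> \<le> 1 / (2 ^ i * \<delta>\<^sup>2) * \<delta>"
      using fejer_le_dist_int[of x "2 ^ i"] \<delta> by (intro mult_right_mono) (auto simp: \<delta>_def)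
    hence 2: "fejer (2 ^ i) x * \<delta> \<le> 1 / y" using \<delta> by (simp add: y_def power2_eq_square)
    have eq: "T (2 * y) - T y = y / ((1 + y) * (1 + 2 * y))"
      using y by (simp add: T_def divide_simps) (simp add: algebra_simps)
    have "min y (1 / y) \<le> 6 * (y / ((1 + y) * (1 + 2 * y)))"
    proof (cases "y \<le> 1")
      case True
      have "(1 + y) * (1 + 2 * y) \<le> 2 * 3" using True y by (intro mult_mono) auto
      hence "y * ((1 + y) * (1 + 2 * y)) \<le> y * 6" using y by (intro mult_left_mono) auto
      moreover have "(1 + y) * (1 + 2 * y) > 0" using y by simp
      ultimately have "y \<le> y * 6 / ((1 + y) * (1 + 2 * y))" by (simp only: pos_le_divide_eq)
      thus ?thesis by (simp add: mult.commute)
    next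
      case False
      have "(1 + y) * (1 + 2 * y) \<le> (2 * y) * (3 * y)" using False y by (intro mult_mono) auto
      hence "1 / y \<le> 6 * (y / ((1 + y) * (1 + 2 * y)))" using y by (simp add: field_simps)
      thus ?thesis by linarith
    qed
    with 1 2 have "fejer (2 ^ i) x * \<delta> \<le> 6 * (T (2 * y) - T y)" unfolding eq by linarith
    thus ?thesis by (simp add: y_def mult.assoc)
  qed
  have "fejer_sum J x * \<delta> = (\<Sum>i<J. fejer (2 ^ i) x * \<delta>)"
    by (simp add: fejer_sum_def sum_distrib_right)
  also have "\<dots> \<le> (\<Sum>i<J. 6 * (T (2 ^ Suc i * \<delta>) - T (2 ^ i * \<delta>)))"
    by (intro sum_mono step)
  also have "\<dots> = 6 * (T (2 ^ J * \<delta>) - T (2 ^ 0 * \<delta>))"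
    by (simp only: sum_distrib_left[symmetric] sum_lessThan_telescope[where f = "\<lambda>i. T (2 ^ i * \<delta>)"])
  also have "\<dots> \<le> 6"
  proof -
    have "6 * (a - b) \<le> 6" if "a \<le> 1" "b \<ge> 0" for a b :: real using that by simp
    thus ?thesis by this (use \<delta> in \<open>auto simp: T_def\<close>)
  qed
  finally show ?thesis by (simp add: \<delta>_def)
qed simp

text \<open>One index for each term of the squared modulus: the level i and the pair (l, l') whose
  difference is the frequency. Equal frequencies are not collected, so the coefficients stay
  explicit and nonnegative, and products expand over \<open>PiE\<close>.\<close>

definition fejer_ix :: "nat \<Rightarrow> (nat \<times> nat \<times> nat) set" where
  "fejer_ix J = (SIGMA i:{..<J}. {..<2 ^ i} \<times> {..<2 ^ i})"

definition fejer_wt :: "nat \<times> nat \<times> nat \<Rightarrow> real" where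
  "fejer_wt p = 1 / 2 ^ fst p"

definition fejer_fr :: "nat \<times> nat \<times> nat \<Rightarrow> int" where
  "fejer_fr p = int (fst (snd p)) - int (snd (snd p))"

lemma finite_fejer_ix [simp]: "finite (fejer_ix J)"
  by (simp add: fejer_ix_def)

lemma fejer_wt_nonneg [simp]: "0 \<le> fejer_wt p"
  by (simp add: fejer_wt_def)

lemma sum_fejer_ix: "(\<Sum>p\<in>fejer_ix J. f p) = (\<Sum>i<J. \<Sum>l<2 ^ i. \<Sum>l'<2 ^ i. f (i, l, l'))"
proof -
  have "(\<Sum>i<J. \<Sum>l<2 ^ i. \<Sum>l'<2 ^ i. f (i, l, l')) = (\<Sum>i<J. \<Sum>q\<in>{..<2 ^ i} \<times> {..<2 ^ i}. f (i, q))"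
    by (simp add: sum.cartesian_product case_prod_unfold)
  also have "\<dots> = (\<Sum>p\<in>fejer_ix J. f p)"
    unfolding fejer_ix_def by (subst sum.Sigma) auto
  finally show ?thesis ..
qed

lemma abs_fejer_fr_less: "p \<in> fejer_ix J \<Longrightarrow> \<bar>fejer_fr p\<bar> < 2 ^ J"
proof -
  assume "p \<in> fejer_ix J"
  then obtain i l l' where p: "p = (i, l, l')" "i < J" "l < 2 ^ i" "l' < 2 ^ i" by (auto simp: fejer_ix_def)
  have "(2::nat) ^ i \<le> 2 ^ J" using p(2) by (intro power_increasing) auto
  hence "int l < int (2 ^ J)" "int l' < int (2 ^ J)" using p by linarith+
  hence "\<bar>int l - int l'\<bar> < int (2 ^ J)" by linarith
  thus ?thesis by (simp add: p fejer_fr_def)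
qed

lemma sum_fejer_wt: "(\<Sum>p\<in>fejer_ix J. fejer_wt p) \<le> 2 ^ J"
proof -
  have "(\<Sum>p\<in>fejer_ix J. fejer_wt p) = (\<Sum>i<J. 2 ^ i)"
    by (simp add: sum_fejer_ix fejer_wt_def)
  also have "\<dots> \<le> (2 :: real) ^ J" by (induction J) auto
  finally show ?thesis .
qed

text \<open>Frequency 0 comes from the 2^i pairs l = l' of weight 2^(-i), so every level contributes
  1. The resulting mean J is the source of the logarithms in \<open>Psi_tilde\<close>, one for each
  of the d coordinates.\<close>

lemma sum_fejer_wt_diagonal: "(\<Sum>p\<in>{p\<in>fejer_ix J. fejer_fr p = 0}. fejer_wt p) = J"
proof -
  have "(\<Sum>p\<in>{p\<in>fejer_ix J. fejer_fr p = 0}. fejer_wt p) =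
      (\<Sum>p\<in>fejer_ix J. if fejer_fr p = 0 then fejer_wt p else 0)"
    by (rule sum.inter_filter) simp
  also have "\<dots> = (\<Sum>i<J. 1)"
    by (simp add: sum_fejer_ix fejer_wt_def fejer_fr_def sum.delta)
  finally show ?thesis by simp
qed

lemma fejer_sum_expand:
  "complex_of_real (fejer_sum J x) =
     (\<Sum>p\<in>fejer_ix J. complex_of_real (fejer_wt p) * cisn (of_int (fejer_fr p) * x))"
proof -
  have "complex_of_real (fejer (2 ^ i) x) =
      (\<Sum>l<2 ^ i. \<Sum>l'<2 ^ i. complex_of_real (1 / 2 ^ i) * cisn (of_int (int l - int l') * x))" for i
  proof -
    let ?Z = "\<Sum>l<2 ^ i. cisn (real l * x)"
    have "complex_of_real (fejer (2 ^ i) x) = complex_of_real (1 / 2 ^ i) * complex_of_real ((norm ?Z)\<^sup>2)"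
      by (simp add: fejer_def)
    also have "complex_of_real ((norm ?Z)\<^sup>2) = ?Z * cnj ?Z" by (simp only: complex_norm_square)
    also have "\<dots> = (\<Sum>l<2 ^ i. \<Sum>l'<2 ^ i. cisn (of_int (int l - int l') * x))"
      by (simp add: sum_product cis_cnj cis_mult algebra_simps)
    finally show ?thesis by (simp add: sum_distrib_left)
  qed
  thus ?thesis by (simp add: fejer_sum_def sum_fejer_ix fejer_wt_def fejer_fr_def)
qed

lemma cisn_sum: "finite I \<Longrightarrow> cisn (\<Sum>i\<in>I. f i) = (\<Prod>i\<in>I. cisn (f i))"
proof (induction I rule: finite_induct)
  case (insert i I)
  show ?case
    by (simp only: sum.insert[OF insert.hyps] prod.insert[OF insert.hyps] cisn_add insert.IH)
qed simp

text \<open>Expanding all factors gives a sum over frequency vectors. The zero vector yields the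
  main term; every other one is controlled by B, and the total mass of the coefficients is at most
  2^(J d).\<close>

lemma sum_prod_fejer_sum:
  fixes S :: "nat set" and \<alpha> \<gamma> :: "nat \<Rightarrow> real" and B :: real
  assumes S: "finite S" and B: "B \<ge> 0"
    and bound: "\<And>h :: nat \<Rightarrow> int. \<exists>i\<in>{1..d}. h i \<noteq> 0 \<Longrightarrow> \<forall>i\<in>{1..d}. \<bar>h i\<bar> < 2 ^ J \<Longrightarrow>
      norm (\<Sum>n\<in>S. cisn (real n * (\<Sum>i=1..d. of_int (h i) * \<alpha> i))) \<le> B"
  shows "\<bar>(\<Sum>n\<in>S. \<Prod>i=1..d. fejer_sum J (real n * \<alpha> i - \<gamma> i)) - card S * real J ^ d\<bar> \<le> B * 2 ^ (J * d)"
proof -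
  let ?X = "PiE {1..d} (\<lambda>_. fejer_ix J)"
  let ?Z = "PiE {1..d} (\<lambda>_. {p\<in>fejer_ix J. fejer_fr p = 0})"
  define wt where "wt = (\<lambda>f. \<Prod>i=1..d. fejer_wt (f i))"
  \<comment> \<open>The shift \<gamma> enters only through this unimodular phase, so all bounds are
    uniform in \<gamma>.\<close>
  define ph where "ph = (\<lambda>f. cisn (- (\<Sum>i=1..d. of_int (fejer_fr (f i)) * \<gamma> i)))"
  define E where "E = (\<lambda>f. \<Sum>n\<in>S. cisn (real n * (\<Sum>i=1..d. of_int (fejer_fr (f i)) * \<alpha> i)))"
  have finX: "finite ?X" by (intro finite_PiE) auto
  have wt_nonneg: "wt f \<ge> 0" for f by (simp add: wt_def prod_nonneg)
  have sum_wt: "(\<Sum>f\<in>?X. wt f) \<le> 2 ^ (J * d)"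
  proof -
    have "(\<Sum>f\<in>?X. wt f) = (\<Prod>i=1..d. \<Sum>p\<in>fejer_ix J. fejer_wt p)"
      unfolding wt_def by (rule prod_sum_PiE[symmetric]) auto
    also have "\<dots> = (\<Sum>p\<in>fejer_ix J. fejer_wt p) ^ d" by simp
    also have "\<dots> \<le> (2 ^ J) ^ d" by (intro power_mono sum_fejer_wt sum_nonneg) auto
    finally show ?thesis by (simp add: power_mult)
  qed
  have sum_wt_Z: "(\<Sum>f\<in>?Z. wt f) = real J ^ d"
  proof -
    have "(\<Sum>f\<in>?Z. wt f) = (\<Prod>i=1..d. \<Sum>p\<in>{p\<in>fejer_ix J. fejer_fr p = 0}. fejer_wt p)"
      unfolding wt_def by (rule prod_sum_PiE[symmetric]) auto
    thus ?thesis by (simp add: sum_fejer_wt_diagonal)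
  qed
  have ZX: "?Z \<subseteq> ?X" by (intro PiE_mono) auto
  have expand: "complex_of_real (\<Prod>i=1..d. fejer_sum J (real n * \<alpha> i - \<gamma> i)) =
      (\<Sum>f\<in>?X. of_real (wt f) * ph f * cisn (real n * (\<Sum>i=1..d. of_int (fejer_fr (f i)) * \<alpha> i)))" for n
  proof -
    have "complex_of_real (\<Prod>i=1..d. fejer_sum J (real n * \<alpha> i - \<gamma> i)) =
       (\<Prod>i=1..d. \<Sum>p\<in>fejer_ix J. of_real (fejer_wt p) * cisn (of_int (fejer_fr p) * (real n * \<alpha> i - \<gamma> i)))"
      by (simp only: of_real_prod fejer_sum_expand)
    also have "\<dots> = (\<Sum>f\<in>?X. \<Prod>i=1..d. of_real (fejer_wt (f i)) * cisn (of_int (fejer_fr (f i)) * (real n * \<alpha> i - \<gamma> i)))"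
      by (rule prod_sum_PiE) auto
    also have "\<dots> = (\<Sum>f\<in>?X. of_real (wt f) * ph f * cisn (real n * (\<Sum>i=1..d. of_int (fejer_fr (f i)) * \<alpha> i)))"
    proof (intro sum.cong refl)
      fix f
      have "(\<Sum>i=1..d. of_int (fejer_fr (f i)) * (real n * \<alpha> i - \<gamma> i)) =
          - (\<Sum>i=1..d. of_int (fejer_fr (f i)) * \<gamma> i) + real n * (\<Sum>i=1..d. of_int (fejer_fr (f i)) * \<alpha> i)"
        by (simp add: sum_distrib_left sum_subtractf algebra_simps)
      hence "(\<Prod>i=1..d. cisn (of_int (fejer_fr (f i)) * (real n * \<alpha> i - \<gamma> i))) =
          ph f * cisn (real n * (\<Sum>i=1..d. of_int (fejer_fr (f i)) * \<alpha> i))"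
        by (simp only: cisn_sum[symmetric] finite_atLeastAtMost ph_def cisn_add)
      thus "(\<Prod>i=1..d. of_real (fejer_wt (f i)) * cisn (of_int (fejer_fr (f i)) * (real n * \<alpha> i - \<gamma> i))) =
          of_real (wt f) * ph f * cisn (real n * (\<Sum>i=1..d. of_int (fejer_fr (f i)) * \<alpha> i))"
        by (simp only: prod.distrib wt_def of_real_prod mult.assoc)
    qed
    finally show ?thesis .
  qed
  have "complex_of_real (\<Sum>n\<in>S. \<Prod>i=1..d. fejer_sum J (real n * \<alpha> i - \<gamma> i)) =
      (\<Sum>n\<in>S. \<Sum>f\<in>?X. of_real (wt f) * ph f * cisn (real n * (\<Sum>i=1..d. of_int (fejer_fr (f i)) * \<alpha> i)))"
    by (simp only: of_real_sum expand)
  also have "\<dots> = (\<Sum>f\<in>?X. of_real (wt f) * ph f * E f)"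
    by (subst sum.swap) (simp only: E_def sum_distrib_left)
  also have "\<dots> = (\<Sum>f\<in>?X - ?Z. of_real (wt f) * ph f * E f) + (\<Sum>f\<in>?Z. of_real (wt f) * ph f * E f)"
    by (rule sum.subset_diff[OF ZX finX])
  also have "(\<Sum>f\<in>?Z. of_real (wt f) * ph f * E f) = (\<Sum>f\<in>?Z. of_real (wt f) * of_nat (card S))"
  proof (intro sum.cong refl)
    fix f assume f: "f \<in> ?Z"
    hence "fejer_fr (f i) = 0" if "i \<in> {1..d}" for i using that by (auto simp: PiE_iff)
    hence "(\<Sum>i=1..d. of_int (fejer_fr (f i)) * g i) = (0::real)" for g :: "nat \<Rightarrow> real"
      by (intro sum.neutral) auto
    hence "ph f = 1" "E f = of_nat (card S)" by (simp_all add: ph_def E_def)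
    thus "of_real (wt f) * ph f * E f = of_real (wt f) * of_nat (card S)" by simp
  qed
  also have "\<dots> = complex_of_real (card S * real J ^ d)"
    by (simp only: sum_distrib_right[symmetric] of_real_sum[symmetric] sum_wt_Z) simp
  finally have "complex_of_real ((\<Sum>n\<in>S. \<Prod>i=1..d. fejer_sum J (real n * \<alpha> i - \<gamma> i)) - card S * real J ^ d)
      = (\<Sum>f\<in>?X - ?Z. of_real (wt f) * ph f * E f)"
    by (simp only: of_real_diff add_diff_cancel_right')
  hence "\<bar>(\<Sum>n\<in>S. \<Prod>i=1..d. fejer_sum J (real n * \<alpha> i - \<gamma> i)) - card S * real J ^ d\<bar> =
      norm (\<Sum>f\<in>?X - ?Z. of_real (wt f) * ph f * E f)"
    by (subst norm_of_real[where 'a = complex, symmetric]) (rule arg_cong)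
  also have "\<dots> \<le> (\<Sum>f\<in>?X - ?Z. wt f * B)"
  proof (rule sum_norm_le)
    fix f assume f: "f \<in> ?X - ?Z"
    have fX: "f i \<in> fejer_ix J" if "i \<in> {1..d}" for i using f that by (auto simp: PiE_iff)
    have "norm (E f) \<le> B" unfolding E_def
    proof (rule bound)
      show "\<exists>i\<in>{1..d}. fejer_fr (f i) \<noteq> 0"
      proof (rule ccontr)
        assume "\<not> ?thesis"
        hence "f \<in> ?Z" using f by (auto simp: PiE_iff)
        thus False using f by simp
      qed
      show "\<forall>i\<in>{1..d}. \<bar>fejer_fr (f i)\<bar> < 2 ^ J" using fX abs_fejer_fr_less by blast
    qed
    moreover have "norm (ph f) = 1" by (simp add: ph_def)
    ultimately show "norm (of_real (wt f) * ph f * E f) \<le> wt f * B"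
      using wt_nonneg[of f] by (simp add: norm_mult mult_left_mono)
  qed
  also have "\<dots> \<le> (\<Sum>f\<in>?X. wt f * B)"
    using finX wt_nonneg B by (intro sum_mono2) auto
  also have "\<dots> = B * (\<Sum>f\<in>?X. wt f)" by (simp add: sum_distrib_left mult.commute)
  also have "\<dots> \<le> B * 2 ^ (J * d)" using B sum_wt by (intro mult_left_mono)
  finally show ?thesis .
qed

section \<open>Weights on dyadic blocks\<close>

lemma multiples_in_interval:
  fixes q u v :: nat
  assumes q: "q > 0" and uv: "u \<le> v"
  obtains a b where "{n\<in>{u..<v}. q dvd n} = (\<lambda>m. q * m) ` {a..<b}"
    "real (card {n\<in>{u..<v}. q dvd n}) \<le> (real v - real u) / q + 1"
proof -
  \<comment> \<open>\<open>a\<close> and \<open>b\<close> are u / q and v / q rounded up, so {a..<b}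
    is exactly the range of the cofactors.\<close>
  define a where "a = (u + q - 1) div q"
  define b where "b = (v + q - 1) div q"
  have iff: "(w + q - 1) div q \<le> m \<longleftrightarrow> w \<le> q * m" for w m
  proof -
    have "(w + q - 1) div q \<le> m \<longleftrightarrow> (w + q - 1) div q < Suc m" by (simp only: less_Suc_eq_le)
    also have "\<dots> \<longleftrightarrow> w + q - 1 < Suc m * q" using q by (rule div_less_iff_less_mult)
    also have "\<dots> \<longleftrightarrow> w \<le> q * m" using q by (auto simp: algebra_simps)
    finally show ?thesis .
  qed
  have mem: "m \<in> {a..<b} \<longleftrightarrow> u \<le> q * m \<and> q * m < v" for m
    using iff[of u m] iff[of v m] by (auto simp: a_def b_def not_le[symmetric])
  have eq: "{n\<in>{u..<v}. q dvd n} = (\<lambda>m. q * m) ` {a..<b}"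
  proof -
    have "{a..<b} = {m. u \<le> q * m \<and> q * m < v}" using mem by blast
    thus ?thesis by (auto elim!: dvdE)
  qed
  have "card {n\<in>{u..<v}. q dvd n} = b - a"
    unfolding eq using q by (subst card_image) (auto simp: inj_on_def)
  moreover have "real (b - a) \<le> (real v - real u) / q + 1"
  proof (cases "a < b")
    case True
    have "u \<le> q * a" "q * (b - 1) < v" using mem[of a] mem[of "b - 1"] True by auto
    hence "real u \<le> real q * real a" "real q * (real b - 1) < real v"
      using True by (metis of_nat_le_iff of_nat_mult, metis of_nat_less_iff of_nat_mult of_nat_diff of_nat_1 less_one not_less0 Suc_leI One_nat_def gr_implies_not0 not_le)
    hence "real q * (real b - 1 - real a) \<le> real v - real u" by (simp add: algebra_simps)
    hence "real b - 1 - real a \<le> (real v - real u) / q" using q by (simp add: field_simps)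
    thus ?thesis using True by (simp add: of_nat_diff)
  next
    case False
    thus ?thesis using uv by simp
  qed
  ultimately show ?thesis using that[OF eq] by simp
qed

lemma sum_inverse_squares_le:
  fixes D M :: nat
  assumes "D > 0"
  shows "(\<Sum>q\<in>{D<..M}. 1 / (real q)\<^sup>2) \<le> 1 / D"
proof (cases "D \<le> M")
  case True
  have "(\<Sum>q\<in>{D<..M}. 1 / (real q)\<^sup>2) \<le> 1 / D - 1 / M"
    using True
  proof (induction M rule: dec_induct)
    case (step M)
    have M: "real M > 0" using step assms by simp
    have "{D<..Suc M} = insert (Suc M) {D<..M}" using step by auto
    hence "(\<Sum>q\<in>{D<..Suc M}. 1 / (real q)\<^sup>2) = 1 / (real (Suc M))\<^sup>2 + (\<Sum>q\<in>{D<..M}. 1 / (real q)\<^sup>2)"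
      by simp
    also have "\<dots> \<le> 1 / (real M * real (Suc M)) + (1 / D - 1 / M)"
      using M step.IH by (intro add_mono divide_left_mono) (auto simp: power2_eq_square)
    also have "\<dots> = 1 / D - 1 / real (Suc M)" using M by (simp add: divide_simps) (simp add: algebra_simps)
    finally show ?case .
  qed simp
  thus ?thesis by (rule order.trans) simp
qed (use assms in simp)

text \<open>Stands in for the product of the reciprocals of the distances, up to a factor 6^d and
  truncated at 2^J in each coordinate. Unlike that product it has a finite Fourier
  expansion.\<close>

definition bohr_weight :: "nat \<Rightarrow> (nat \<Rightarrow> real) \<Rightarrow> (nat \<Rightarrow> real) \<Rightarrow> nat \<Rightarrow> nat \<Rightarrow> real" where
  "bohr_weight d \<alpha> \<gamma> J n = (\<Prod>i=1..d. fejer_sum J (real n * \<alpha> i - \<gamma> i))"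

lemma bohr_weight_nonneg [simp]: "0 \<le> bohr_weight d \<alpha> \<gamma> J n"
  by (simp add: bohr_weight_def prod_nonneg)

lemma bohr_weight_le: "bohr_weight d \<alpha> \<gamma> J n \<le> 2 ^ (J * d)"
proof -
  have "bohr_weight d \<alpha> \<gamma> J n \<le> (\<Prod>i=1..d. 2 ^ J)"
    unfolding bohr_weight_def by (intro prod_mono) (auto simp: fejer_sum_le)
  thus ?thesis by (simp add: power_mult)
qed

lemma bohr_weight_mult_dist_int_le:
  "bohr_weight d \<alpha> \<gamma> J n * (\<Prod>i=1..d. dist_int (real n * \<alpha> i - \<gamma> i)) \<le> 6 ^ d"
proof -
  have "bohr_weight d \<alpha> \<gamma> J n * (\<Prod>i=1..d. dist_int (real n * \<alpha> i - \<gamma> i)) =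
      (\<Prod>i=1..d. fejer_sum J (real n * \<alpha> i - \<gamma> i) * dist_int (real n * \<alpha> i - \<gamma> i))"
    by (simp add: bohr_weight_def prod.distrib)
  also have "\<dots> \<le> (\<Prod>i=1..d. 6)"
    by (intro prod_mono) (auto simp: fejer_sum_mult_dist_int_le)
  finally show ?thesis by simp
qed

text \<open>Writing n = q m replaces the frequency vector h by q h, of height at most q 2^J, and the
  linear form bound applies to it. The dependence on q is polynomial, which later allows q to grow
  like a power of the block length.\<close>

lemma sum_bohr_weight_multiples:
  assumes lf: "linear_form_bounded d \<alpha> A c" and q: "q > 0" and uv: "u \<le> v"
  shows "\<bar>(\<Sum>n\<in>{n\<in>{u..<v}. q dvd n}. bohr_weight d \<alpha> \<gamma> J n) - card {n\<in>{u..<v}. q dvd n} * real J ^ d\<bar>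
           \<le> (real q * 2 ^ J) ^ A / c * 2 ^ (J * d)"
  unfolding bohr_weight_def
proof (rule sum_prod_fejer_sum)
  have c: "c > 0" using lf by (simp add: linear_form_bounded_def)
  thus "0 \<le> (real q * 2 ^ J) ^ A / c" by simp
  fix h :: "nat \<Rightarrow> int"
  assume h: "\<exists>i\<in>{1..d}. h i \<noteq> 0" "\<forall>i\<in>{1..d}. \<bar>h i\<bar> < 2 ^ J"
  define \<theta> where "\<theta> = (\<Sum>i=1..d. of_int (int q * h i) * \<alpha> i)"
  have \<theta>: "\<theta> = real q * (\<Sum>i=1..d. of_int (h i) * \<alpha> i)"
    by (simp add: \<theta>_def sum_distrib_left mult.assoc)
  have "\<bar>int q * h i\<bar> \<le> int (q * 2 ^ J)" if "i \<in> {1..d}" for i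
  proof -
    have "int q * \<bar>h i\<bar> \<le> int q * 2 ^ J" using h(2) that by (intro mult_left_mono) (auto intro: less_imp_le)
    thus ?thesis by (simp add: abs_mult)
  qed
  moreover have "\<exists>i\<in>{1..d}. int q * h i \<noteq> 0" using h(1) q by auto
  ultimately have "c \<le> dist_int \<theta> * real (q * 2 ^ J) ^ A"
    unfolding \<theta>_def by (intro linear_form_boundedD[OF lf, where h = "\<lambda>i. int q * h i"])
  hence le: "c \<le> dist_int \<theta> * (real q * 2 ^ J) ^ A" by simp
  have pos: "dist_int \<theta> > 0"
  proof -
    have "dist_int \<theta> \<noteq> 0" using le c by auto
    thus ?thesis using dist_int_nonneg[of \<theta>] by linarith
  qed
  obtain a b where ab: "{n\<in>{u..<v}. q dvd n} = (\<lambda>m. q * m) ` {a..<b}"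
    using multiples_in_interval[OF q uv] by metis
  have "(\<Sum>n\<in>{n\<in>{u..<v}. q dvd n}. cisn (real n * (\<Sum>i=1..d. of_int (h i) * \<alpha> i))) =
        (\<Sum>m\<in>{a..<b}. cisn (real m * \<theta>))"
    unfolding ab using q by (subst sum.reindex) (auto simp: inj_on_def \<theta> mult_ac)
  also have "norm \<dots> \<le> 1 / dist_int \<theta>" by (rule norm_sum_cisn_le[OF pos])
  also have "\<dots> \<le> (real q * 2 ^ J) ^ A / c" using le pos c by (simp add: field_simps)
  finally show "norm (\<Sum>n\<in>{n\<in>{u..<v}. q dvd n}. cisn (real n * (\<Sum>i=1..d. of_int (h i) * \<alpha> i)))
      \<le> (real q * 2 ^ J) ^ A / c" .
qed simp

text \<open>The degree \<open>2 ^ (j div s)\<close> of the weights on the block of \<open>j\<close> is a power of the block length small enough for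
  the error terms to be negligible for all divisors \<open>q \<le> 2 ^ (j div r)\<close>; larger divisors are so rare that the
  trivial bound \<open>bohr_weight_le\<close> suffices.\<close>

lemma block_parameters:
  fixes d A s :: nat and c :: real
  assumes d: "d > 0" and c: "c > 0" and s: "s \<ge> 4 * (d + A)" "s \<ge> 8 * (A + 1) * d"
  defines "r \<equiv> 4 * (A + 1)"
  obtains j0 where "\<And>j. j \<ge> j0 \<Longrightarrow> j div s \<ge> 1"
    "\<And>j. j \<ge> j0 \<Longrightarrow> 2 * 2 ^ (j div s * (d + A) + j div r * (A + 1)) \<le> c * 2 ^ j"
    "\<And>j. j \<ge> j0 \<Longrightarrow> 3 * 2 ^ (j div s * d) * (real j)\<^sup>2 \<le> 2 ^ (j div r)"
proof -
  have s0: "s > 0" using s(1) d by simp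
  have r0: "r > 0" by (simp add: r_def)
  obtain n0 :: nat where n0: "2 / c < 2 ^ n0" using real_arch_pow[of 2 "2 / c"] by auto
  obtain p0 where p0: "\<And>p. p \<ge> p0 \<Longrightarrow> 3 * (real r)\<^sup>2 * (2 * real p + 1)\<^sup>2 \<le> 2 ^ p"
  proof -
    have "(\<lambda>p. real p / sqrt 2 ^ p) \<longlonglongrightarrow> 0"
      by (rule lim_n_over_pown) simp
    hence "eventually (\<lambda>p. real p / sqrt 2 ^ p < 1 / (6 * real r)) sequentially"
      using r0 by (intro order_tendstoD(2)) auto
    then obtain p1 where p1: "\<And>p. p \<ge> p1 \<Longrightarrow> real p / sqrt 2 ^ p < 1 / (6 * real r)"
      by (auto simp: eventually_sequentially)
    show ?thesis
    proof (rule that[of "max 1 p1"])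
      fix p assume p: "p \<ge> max 1 p1"
      have "2 * real r * (2 * real p + 1) \<le> 2 * real r * (3 * real p)" using p by (intro mult_left_mono) auto
      also have "\<dots> \<le> sqrt 2 ^ p" using p1[of p] p r0 by (simp add: field_simps)
      finally have "(2 * real r * (2 * real p + 1))\<^sup>2 \<le> (sqrt 2 ^ p)\<^sup>2" by (intro power_mono) auto
      also have "(sqrt 2 ^ p)\<^sup>2 = 2 ^ p" by (simp flip: power_mult_distrib add: power2_eq_square)
      finally have "4 * ((real r)\<^sup>2 * (2 * real p + 1)\<^sup>2) \<le> 2 ^ p"
        by (simp add: power_mult_distrib mult.assoc)
      moreover have "0 \<le> (real r)\<^sup>2 * (2 * real p + 1)\<^sup>2" by simp
      ultimately show "3 * (real r)\<^sup>2 * (2 * real p + 1)\<^sup>2 \<le> 2 ^ p" unfolding mult.assoc by linarith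
    qed
  qed
  show ?thesis
  \<comment> \<open>The three summands guarantee j div s >= 1, room for the factor 2 / c, and p >=
    p0 at the end.\<close>
  proof (rule that[of "s + 2 * n0 + 2 * r * p0"])
    fix j assume "j \<ge> s + 2 * n0 + 2 * r * p0"
    hence j: "j \<ge> s" "j \<ge> 2 * n0" "j \<ge> 2 * r * p0" by auto
    show "j div s \<ge> 1" using j(1) s0 by (simp add: Suc_leI div_greater_zero_iff)
    define J where "J = j div s"
    define m where "m = j div r"
    have sJ: "s * J \<le> j" by (simp add: J_def)
    have rm: "r * m \<le> j" by (simp add: m_def)
    have rm2: "j < r * (m + 1)" unfolding m_def using r0 by (metis Suc_eq_plus1 dividend_less_times_div mult_Suc_right add.commute)
    \<comment> \<open>Each of the two parts of the exponent \<open>E\<close> uses at most a quarter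
      of j; of the remaining half, n0 pays for 2 / c.\<close>
    have "4 * (d + A) * J \<le> j" using mult_right_mono[OF s(1), of J] sJ by linarith
    moreover have "4 * (A + 1) * m \<le> j" using rm by (simp add: r_def)
    ultimately have e: "2 * (J * (d + A) + m * (A + 1)) \<le> j" by (simp add: algebra_simps)
    define E where "E = J * (d + A) + m * (A + 1)"
    have "2 * E \<le> j" using e by (simp only: E_def)
    hence "j = n0 + E + (j - n0 - E)"
      using j(2) by linarith
    hence "(2::real) ^ j = 2 ^ n0 * 2 ^ E * 2 ^ (j - n0 - E)"
      by (metis power_add)
    also have "\<dots> \<ge> 2 ^ n0 * 2 ^ E * 1"
      by (intro mult_left_mono one_le_power) auto
    finally have "2 ^ n0 * 2 ^ E \<le> (2::real) ^ j" by simp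
    moreover have "2 / c * 2 ^ E \<le> 2 ^ n0 * 2 ^ E"
      using n0 by (intro mult_right_mono) auto
    ultimately have "2 / c * 2 ^ E \<le> (2::real) ^ j" by linarith
    hence "2 * 2 ^ E \<le> c * 2 ^ j" using c by (simp add: field_simps)
    thus "2 * 2 ^ (j div s * (d + A) + j div r * (A + 1)) \<le> c * 2 ^ j"
      by (simp only: E_def J_def m_def)
    \<comment> \<open>As s >= 2 r d, the trivial bound 2^(J d) uses at most half of the exponent m.
      The rest, p, outgrows j^2 because j < r (2 p + 1).\<close>
    have "2 * r * d * J \<le> s * J" using s(2) by (intro mult_right_mono) (auto simp: r_def)
    hence "r * (2 * d * J) \<le> s * J" by (simp only: mult_ac)
    hence "r * (2 * d * J) < r * (m + 1)" using sJ rm2 by linarith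
    hence "2 * d * J < m + 1" by (simp only: mult_less_cancel1)
    hence dJ: "2 * (J * d) \<le> m" by (simp add: mult_ac)
    define p where "p = m - J * d"
    have p: "m = J * d + p" "m \<le> 2 * p" using dJ by (auto simp: p_def)
    have "2 * p0 \<le> m" using j(3) r0 by (simp add: m_def less_eq_div_iff_mult_less_eq mult_ac)
    hence "p0 \<le> p" using p by linarith
    have "real j \<le> real (r * (2 * p + 1))"
    proof -
      have "r * (m + 1) \<le> r * (2 * p + 1)" using p by (intro mult_left_mono) auto
      thus ?thesis using rm2 by linarith
    qed
    hence "(real j)\<^sup>2 \<le> (real r * (2 * real p + 1))\<^sup>2" by (intro power_mono) (auto simp: algebra_simps)
    hence "3 * (real j)\<^sup>2 \<le> 3 * (real r)\<^sup>2 * (2 * real p + 1)\<^sup>2" by (simp add: power_mult_distrib)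
    also have "\<dots> \<le> 2 ^ p" by (rule p0[OF \<open>p0 \<le> p\<close>])
    finally have "2 ^ (J * d) * (3 * (real j)\<^sup>2) \<le> 2 ^ (J * d) * 2 ^ p" by (intro mult_left_mono) auto
    also have "\<dots> = 2 ^ m" by (simp add: p power_add)
    finally show "3 * 2 ^ (j div s * d) * (real j)\<^sup>2 \<le> 2 ^ (j div r)"
      by (simp add: J_def m_def mult_ac)
  qed
qed

text \<open>\<open>j0\<close> depends on \<alpha> through c, but not on \<gamma> or D. For the
  second bound the sums are exchanged: multiples of q carry about 1 / q of the weight, so q
  contributes O(1 / q^2), and the tail beyond D is O(1 / D). The 8 is 2 (3 + 1): 3 from divisors in
  general, 1 from the range where only the trivial bound is available, 2 from comparing the expected
  weight G with the actual one.\<close>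

lemma block_estimates:
  fixes d A s :: nat and c :: real and \<alpha> :: "nat \<Rightarrow> real"
  assumes d: "d > 0" and lf: "linear_form_bounded d \<alpha> A c"
    and s: "s \<ge> 4 * (d + A)" "s \<ge> 8 * (A + 1) * d"
  obtains j0 where
    "\<And>j \<gamma>. j \<ge> j0 \<Longrightarrow> 2 ^ j * real (j div s) ^ d \<le> 2 * (\<Sum>n\<in>{2 ^ j..<2 ^ Suc j}. bohr_weight d \<alpha> \<gamma> (j div s) n)"
    "\<And>(j::nat) \<gamma> (D::nat). j \<ge> j0 \<Longrightarrow> D > 0 \<Longrightarrow> D \<le> j\<^sup>2 \<Longrightarrow>
       (\<Sum>n\<in>{2 ^ j..<2 ^ Suc j}. bohr_weight d \<alpha> \<gamma> (j div s) n * (\<Sum>q | q dvd n \<and> q > D. 1 / real q))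
         \<le> 8 / D * (\<Sum>n\<in>{2 ^ j..<2 ^ Suc j}. bohr_weight d \<alpha> \<gamma> (j div s) n)"
proof -
  have c: "c > 0" using lf by (simp add: linear_form_bounded_def)
  define r where "r = 4 * (A + 1)"
  obtain j0 where j0: "\<And>j. j \<ge> j0 \<Longrightarrow> j div s \<ge> 1"
    "\<And>j. j \<ge> j0 \<Longrightarrow> 2 * 2 ^ (j div s * (d + A) + j div r * (A + 1)) \<le> c * 2 ^ j"
    "\<And>j. j \<ge> j0 \<Longrightarrow> 3 * 2 ^ (j div s * d) * (real j)\<^sup>2 \<le> 2 ^ (j div r)"
    using block_parameters[OF d c s] unfolding r_def by metis
  \<comment> \<open>Up to 2^(j div r) the exponential sum error stays below half of 2^j / q; the
    case q = 1 then gives the first conclusion.\<close>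
  have small_q: "\<bar>(\<Sum>n\<in>{n\<in>{2 ^ j..<2 ^ Suc j}. q dvd n}. bohr_weight d \<alpha> \<gamma> (j div s) n)
      - card {n\<in>{2 ^ j..<2 ^ Suc j}. q dvd n} * real (j div s) ^ d\<bar> \<le> 2 ^ j / (2 * real q)"
    if j: "j \<ge> j0" and q: "q > 0" "q \<le> 2 ^ (j div r)" for j q :: nat and \<gamma>
  proof -
    let ?J = "j div s"
    have "(real q * 2 ^ ?J) ^ A / c * 2 ^ (?J * d) * (2 * real q) = 2 * (real q ^ (A + 1) * 2 ^ (?J * (d + A))) / c"
      by (simp add: power_mult_distrib power_add power_mult[symmetric] algebra_simps)
    also have "real q ^ (A + 1) \<le> (2 ^ (j div r)) ^ (A + 1)"
      using of_nat_mono[OF q(2), where 'a = real] by (intro power_mono) auto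
    also have "(2 ^ (j div r)) ^ (A + 1) = (2::real) ^ (j div r * (A + 1))" by (simp only: power_mult)
    finally have "(real q * 2 ^ ?J) ^ A / c * 2 ^ (?J * d) * (2 * real q) \<le>
        2 * (2 ^ (j div r * (A + 1)) * 2 ^ (?J * (d + A))) / c"
      using c by (simp add: divide_right_mono mult_right_mono)
    also have "\<dots> = 2 * 2 ^ (?J * (d + A) + j div r * (A + 1)) / c"
      by (simp only: power_add mult.commute)
    also have "\<dots> \<le> 2 ^ j" using j0(2)[OF j] c by (simp add: field_simps)
    finally have "(real q * 2 ^ ?J) ^ A / c * 2 ^ (?J * d) \<le> 2 ^ j / (2 * real q)"
      using q by (simp add: pos_le_divide_eq)
    thus ?thesis
      using sum_bohr_weight_multiples[OF lf q(1), of "2 ^ j" "2 ^ Suc j" \<gamma> ?J] by simp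
  qed
  have lower: "2 ^ j * real (j div s) ^ d \<le> 2 * (\<Sum>n\<in>{2 ^ j..<2 ^ Suc j}. bohr_weight d \<alpha> \<gamma> (j div s) n)"
    if j: "j \<ge> j0" for j \<gamma>
  proof -
    have "{n\<in>{2 ^ j..<2 ^ Suc j}. Suc 0 dvd n} = {2 ^ j..<2 ^ Suc j}" by auto
    hence "\<bar>(\<Sum>n\<in>{2 ^ j..<2 ^ Suc j}. bohr_weight d \<alpha> \<gamma> (j div s) n) - 2 ^ j * real (j div s) ^ d\<bar> \<le> 2 ^ j / 2"
      using small_q[OF j, of 1 \<gamma>] by simp
    moreover have "(2 ^ j :: real) \<le> 2 ^ j * real (j div s) ^ d"
      using j0(1)[OF j] by simp
    ultimately show ?thesis by linarith
  qed
  show ?thesis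
  proof (rule that[of j0])
    fix j D :: nat and \<gamma> :: "nat \<Rightarrow> real" assume j: "j \<ge> j0" and D: "D > 0" "D \<le> j\<^sup>2"
    let ?J = "j div s" and ?X = "{2 ^ j..<2 ^ Suc j} :: nat set" and ?R = "2 ^ (j div r) :: nat"
    let ?W = "bohr_weight d \<alpha> \<gamma> ?J"
    define G where "G = 2 ^ j * real ?J ^ d"
    have G0: "0 \<le> G" by (simp add: G_def)
    have G: "2 ^ j \<le> G" using j0(1)[OF j] by (simp add: G_def)
    have card_le: "real (card {n\<in>?X. q dvd n}) \<le> 2 ^ j / real q + 1" if "q > 0" for q :: nat
    proof -
      have "real (card {n\<in>?X. q dvd n}) \<le> (real (2 ^ Suc j) - real (2 ^ j)) / q + 1"
        by (rule multiples_in_interval[OF that, of "2 ^ j" "2 ^ Suc j"]) (auto intro: power_increasing)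
      thus ?thesis by simp
    qed
    have card_le3: "real (card {n\<in>?X. q dvd n}) \<le> 3 * (2 ^ j / real q)" if q: "q > 0" "q \<le> 2 ^ Suc j" for q :: nat
    proof -
      have "1 \<le> 2 * (2 ^ j / real q)"
        using of_nat_mono[OF q(2), where 'a = real] q(1) by (simp add: field_simps)
      thus ?thesis using card_le[OF q(1)] by linarith
    qed
    have card_le2: "real (card {n\<in>?X. q dvd n}) \<le> 2 * (2 ^ j / real q)" if q: "q > 0" "q \<le> 2 ^ j" for q :: nat
    proof -
      have "1 \<le> 2 ^ j / real q"
        using of_nat_mono[OF q(2), where 'a = real] q(1) by (simp add: field_simps)
      thus ?thesis using card_le[OF q(1)] by linarith
    qed
    have per_q: "1 / real q * (\<Sum>n\<in>{n\<in>?X. q dvd n}. ?W n) \<le>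
        3 * G * (1 / (real q)\<^sup>2) + (if q > ?R then 3 * 2 ^ j * 2 ^ (?J * d) * (1 / (real q)\<^sup>2) else 0)"
      if q: "q > 0" "q \<le> 2 ^ Suc j" for q :: nat
    proof (cases "q > ?R")
      case True
      have "(\<Sum>n\<in>{n\<in>?X. q dvd n}. ?W n) \<le> real (card {n\<in>?X. q dvd n}) * 2 ^ (?J * d)"
        by (rule sum_bounded_above) (rule bohr_weight_le)
      also have "\<dots> \<le> 3 * (2 ^ j / real q) * 2 ^ (?J * d)" using card_le3[OF q] by (intro mult_right_mono) auto
      finally have "1 / real q * (\<Sum>n\<in>{n\<in>?X. q dvd n}. ?W n) \<le> 1 / real q * (3 * (2 ^ j / real q) * 2 ^ (?J * d))"
        by (intro mult_left_mono) auto
      also have "\<dots> = 3 * 2 ^ j * 2 ^ (?J * d) * (1 / (real q)\<^sup>2)" by (simp add: power2_eq_square)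
      also have "\<dots> \<le> 3 * G * (1 / (real q)\<^sup>2) + \<dots>" by (simp add: G_def)
      finally show ?thesis using True by simp
    next
      case False
      have "?R \<le> 2 ^ j" by (intro power_increasing) auto
      hence "q \<le> 2 ^ j" using False by linarith
      have "(\<Sum>n\<in>{n\<in>?X. q dvd n}. ?W n) \<le> real (card {n\<in>?X. q dvd n}) * real ?J ^ d + 2 ^ j / (2 * real q)"
        using small_q[OF j q(1), of \<gamma>] False by linarith
      also have "\<dots> \<le> 2 * (2 ^ j / real q) * real ?J ^ d + G / q"
      proof (intro add_mono mult_right_mono card_le2)
        have "2 ^ j / (2 * real q) \<le> 2 ^ j / real q" using q by (intro divide_left_mono) auto
        also have "\<dots> \<le> G / q" using G by (intro divide_right_mono) auto
        finally show "2 ^ j / (2 * real q) \<le> G / q" by simp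
      qed (use q \<open>q \<le> 2 ^ j\<close> in auto)
      also have "\<dots> = 3 * G / q" by (simp add: G_def)
      finally have "1 / real q * (\<Sum>n\<in>{n\<in>?X. q dvd n}. ?W n) \<le> 1 / real q * (3 * G / q)"
        by (intro mult_left_mono) auto
      thus ?thesis using False by (simp add: power2_eq_square)
    qed
    have "(\<Sum>n\<in>?X. ?W n * (\<Sum>q | q dvd n \<and> q > D. 1 / real q)) =
        (\<Sum>n\<in>?X. \<Sum>q\<in>{D<..2 ^ Suc j}. if q dvd n then 1 / real q * ?W n else 0)"
    proof (intro sum.cong refl)
      fix n assume n: "n \<in> ?X"
      have "0 < (2::nat) ^ j" by simp
      hence n0: "0 < n" using n unfolding atLeastLessThan_iff by linarith
      have "q \<le> 2 ^ Suc j" if "q dvd n" for q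
        using dvd_imp_le[OF that n0] n unfolding atLeastLessThan_iff by linarith
      hence "{q. q dvd n \<and> q > D} = {q\<in>{D<..2 ^ Suc j}. q dvd n}" by auto
      thus "?W n * (\<Sum>q | q dvd n \<and> q > D. 1 / real q) =
          (\<Sum>q\<in>{D<..2 ^ Suc j}. if q dvd n then 1 / real q * ?W n else 0)"
        by (simp only: mult.commute[of "?W n"] sum_distrib_right sum.inter_filter[symmetric] finite_greaterThanAtMost)
    qed
    also have "\<dots> = (\<Sum>q\<in>{D<..2 ^ Suc j}. 1 / real q * (\<Sum>n\<in>{n\<in>?X. q dvd n}. ?W n))"
      by (subst sum.swap) (simp only: sum.inter_filter[symmetric] finite_atLeastLessThan sum_distrib_left)
    also have "\<dots> \<le> (\<Sum>q\<in>{D<..2 ^ Suc j}. 3 * G * (1 / (real q)\<^sup>2) +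
        (if q > ?R then 3 * 2 ^ j * 2 ^ (?J * d) * (1 / (real q)\<^sup>2) else 0))"
      using D by (intro sum_mono per_q) auto
    also have "\<dots> = 3 * G * (\<Sum>q\<in>{D<..2 ^ Suc j}. 1 / (real q)\<^sup>2) +
        3 * 2 ^ j * 2 ^ (?J * d) * (\<Sum>q\<in>{q\<in>{D<..2 ^ Suc j}. q > ?R}. 1 / (real q)\<^sup>2)"
      by (simp only: sum.distrib sum_distrib_left) (simp only: sum.inter_filter finite_greaterThanAtMost)
    also have "\<dots> \<le> 3 * G * (1 / D) + 3 * 2 ^ j * 2 ^ (?J * d) * (1 / ?R)"
    proof (intro add_mono mult_left_mono sum_inverse_squares_le D)
      have "(\<Sum>q\<in>{q\<in>{D<..2 ^ Suc j}. q > ?R}. 1 / (real q)\<^sup>2) \<le> (\<Sum>q\<in>{?R<..2 ^ Suc j}. 1 / (real q)\<^sup>2)"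
        by (intro sum_mono2) auto
      also have "\<dots> \<le> 1 / real ?R" by (rule sum_inverse_squares_le) simp
      finally show "(\<Sum>q\<in>{q\<in>{D<..2 ^ Suc j}. q > ?R}. 1 / (real q)\<^sup>2) \<le> 1 / real ?R" .
    qed (auto simp: G_def)
    \<comment> \<open>Here D <= j^2 is used: the saving 2^(j div r) beats 2^(J d) and still leaves 1
      / j^2 <= 1 / D.\<close>
    also have "3 * 2 ^ j * 2 ^ (?J * d) * (1 / ?R) \<le> G * (1 / D)"
    proof -
      have "3 * 2 ^ (?J * d) * real D \<le> 3 * 2 ^ (?J * d) * (real j)\<^sup>2"
        using of_nat_mono[OF D(2), where 'a = real] by (intro mult_left_mono) auto
      also have "\<dots> \<le> real ?R" using j0(3)[OF j] by simp
      finally have "3 * 2 ^ (?J * d) * (1 / real ?R) \<le> 1 / D" using D by (simp add: field_simps)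
      hence "2 ^ j * (3 * 2 ^ (?J * d) * (1 / real ?R)) \<le> G * (1 / D)" using G G0 by (intro mult_mono) auto
      thus ?thesis by (simp only: mult_ac)
    qed
    also have "3 * G * (1 / D) + G * (1 / D) = 4 / D * G" by simp
    also have "\<dots> \<le> 4 / D * (2 * (\<Sum>n\<in>?X. ?W n))"
      using lower[OF j, of \<gamma>] by (intro mult_left_mono) (auto simp: G_def)
    finally show "(\<Sum>n\<in>?X. ?W n * (\<Sum>q | q dvd n \<and> q > D. 1 / real q)) \<le> 8 / D * (\<Sum>n\<in>?X. ?W n)"
      by simp
  qed (fact lower)
qed

section \<open>Overlaps of neighbourhoods of fractions\<close>

text \<open>The integers h lie in an open interval of length 2 L s, which contains 0 as |u| < s.
  Splitting at 0 and omitting it, each side has at most as many integers as its length, so no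
  additional 1 appears. This gives the overlap estimate its exact constant and is the reason for
  treating coinciding fractions separately.\<close>

lemma card_nonzero_ints_le:
  fixes u L s :: real
  assumes "\<bar>u\<bar> < s" "L > 0"
  defines "H \<equiv> {h::int. h \<noteq> 0 \<and> \<bar>u + of_int h / L\<bar> < s}"
  shows "finite H" "real (card H) \<le> 2 * L * s"
proof -
  define y z where "y = L * (s - u)" and "z = L * (s + u)"
  have yz: "y \<ge> 0" "z \<ge> 0" using assms by (auto simp: y_def z_def)
  have sub: "H \<subseteq> {1..\<lceil>y\<rceil> - 1} \<union> {1 - \<lceil>z\<rceil>..-1}"
  proof
    fix h assume "h \<in> H"
    hence h: "h \<noteq> 0" "u + of_int h / L < s" "- s < u + of_int h / L"
      by (auto simp: H_def abs_less_iff)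
    have "of_int h < y" "- z < of_int h"
      using h(2,3) assms(2) by (auto simp: y_def z_def field_simps)
    hence "h \<le> \<lceil>y\<rceil> - 1" "1 - \<lceil>z\<rceil> \<le> h" by linarith+
    thus "h \<in> {1..\<lceil>y\<rceil> - 1} \<union> {1 - \<lceil>z\<rceil>..-1}" using h(1) by auto
  qed
  show "finite H" by (rule finite_subset[OF sub]) auto
  have "real (card H) \<le> real (card ({1..\<lceil>y\<rceil> - 1} \<union> {1 - \<lceil>z\<rceil>..-1}))"
    using card_mono[OF _ sub] by simp
  also have "\<dots> \<le> real (nat (\<lceil>y\<rceil> - 1)) + real (nat (\<lceil>z\<rceil> - 1))"
    by (subst card_Un_disjoint) auto
  also have "\<dots> \<le> y + z" using yz by linarith
  also have "\<dots> = 2 * L * s" by (simp add: y_def z_def algebra_simps)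
  finally show "real (card H) \<le> 2 * L * s" .
qed

lemma card_fraction_pairs_le:
  fixes m n :: nat and u s :: real
  assumes "m > 0" "n > 0" "\<bar>u\<bar> < s"
  shows "real (card {(a,b) \<in> {1..m} \<times> {1..n}. a * n \<noteq> b * m \<and> \<bar>real a / m + u - real b / n\<bar> < s})
           \<le> 2 * s * m * n" (is "real (card ?P) \<le> _")
proof -
  define g m' n' where "g = gcd m n" and "m' = m div g" and "n' = n div g"
  have g: "g > 0" "m = g * m'" "n = g * n'" "coprime m' n'"
    using assms by (auto simp: g_def m'_def n'_def div_gcd_coprime)
  have pos: "m' > 0" "n' > 0" using assms g by auto
  \<comment> \<open>L is the least common multiple of m and n; the difference a / m - b / n will be
    f (a, b) / L, and L g = m n.\<close>
  define L where "L = real g * m' * n'"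
  have L: "L > 0" using g pos by (simp add: L_def)
  define H where "H = {h::int. h \<noteq> 0 \<and> \<bar>u + of_int h / L\<bar> < s}"
  note H = card_nonzero_ints_le[OF assms(3) L, folded H_def]
  define f where "f = (\<lambda>(a,b). int a * int n' - int b * int m')"
  have fin: "finite ?P" by (rule finite_subset[of _ "{1..m} \<times> {1..n}"]) auto
  have f: "f ` ?P \<subseteq> H"
  proof safe
    fix a b assume ab: "a \<in> {1..m}" "b \<in> {1..n}" "a * n \<noteq> b * m" "\<bar>real a / m + u - real b / n\<bar> < s"
    have "real_of_int (f (a,b)) / L = real a / m - real b / n"
      using g pos by (simp add: f_def L_def field_simps)
    moreover have "f (a,b) \<noteq> 0"
    proof
      assume "f (a,b) = 0"
      hence "int (a * n') = int (b * m')" by (simp add: f_def)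
      hence "a * n' = b * m'" by (simp only: of_nat_eq_iff)
      thus False using ab(3) g by simp
    qed
    ultimately show "f (a,b) \<in> H" using ab(4) by (simp add: H_def algebra_simps)
  qed
  \<comment> \<open>For fixed h, a is determined modulo m' because m' and n' are coprime, so at most
    g of the m = g m' numerators occur. The quotient is formed with a - 1 since numerators start at
    1.\<close>
  have fib: "card {p \<in> ?P. f p = h} \<le> g" for h
  proof -
    have "inj_on (\<lambda>(a,b). (a - 1) div m') {p \<in> ?P. f p = h}"
    proof (rule inj_onI)
      fix p p2
      assume p: "p \<in> {p \<in> ?P. f p = h}" "p2 \<in> {p \<in> ?P. f p = h}"
        "(\<lambda>(a,b). (a - 1) div m') p = (\<lambda>(a,b). (a - 1) div m') p2"
      obtain a b a2 b2 where p_eq: "p = (a,b)" "p2 = (a2,b2)" by (metis surj_pair)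
      from p have a: "Suc 0 \<le> a" "Suc 0 \<le> a2" "f (a,b) = f (a2,b2)"
        "(a - Suc 0) div m' = (a2 - Suc 0) div m'" by (auto simp: p_eq)
      have eq: "(int a - int a2) * int n' = (int b - int b2) * int m'"
        using a(3) by (simp add: f_def algebra_simps)
      have "int m' dvd (int a - int a2)"
      proof -
        have "int m' dvd (int a - int a2) * int n'" by (simp add: eq)
        moreover have "coprime (int m') (int n')" using g(4) by simp
        ultimately show ?thesis by (simp add: coprime_dvd_mult_left_iff)
      qed
      hence "int m' dvd int (a - Suc 0) - int (a2 - Suc 0)" using a by (simp add: of_nat_diff)
      hence "int (a - Suc 0) mod int m' = int (a2 - Suc 0) mod int m'"
        by (simp only: mod_eq_dvd_iff)
      hence mod_eq: "(a - Suc 0) mod m' = (a2 - Suc 0) mod m'"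
        by (simp only: zmod_int[symmetric] of_nat_eq_iff)
      have "a - Suc 0 = (a - Suc 0) div m' * m' + (a - Suc 0) mod m'"
        by (rule div_mult_mod_eq[symmetric])
      also have "\<dots> = (a2 - Suc 0) div m' * m' + (a2 - Suc 0) mod m'"
        by (simp only: a(4) mod_eq)
      also have "\<dots> = a2 - Suc 0"
        by (rule div_mult_mod_eq)
      finally have "a - Suc 0 = a2 - Suc 0" .
      hence "a = a2" using a by simp
      with eq pos show "p = p2" by (simp add: p_eq)
    qed
    moreover have "(\<lambda>(a,b). (a - 1) div m') ` {p \<in> ?P. f p = h} \<subseteq> {..<g}"
    proof clarsimp
      fix a assume "Suc 0 \<le> a" "a \<le> m"
      hence "a - Suc 0 < g * m'" using g by simp
      thus "(a - Suc 0) div m' < g" by (simp add: less_mult_imp_div_less)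
    qed
    ultimately show ?thesis
      using card_inj_on_le[of "(\<lambda>(a,b). (a - 1) div m')" "{p \<in> ?P. f p = h}" "{..<g}"] by simp
  qed
  have "card ?P = (\<Sum>p\<in>?P. 1)" by simp
  also have "\<dots> = (\<Sum>h\<in>H. \<Sum>p\<in>{p \<in> ?P. f p = h}. 1)"
    by (rule sum.group[OF fin H(1) f, symmetric])
  also have "\<dots> \<le> (\<Sum>h\<in>H. g)" using fib by (intro sum_mono) simp
  also have "\<dots> = card H * g" by simp
  finally have "card ?P \<le> card H * g" .
  hence "real (card ?P) \<le> real (card H * g)" by (simp only: of_nat_le_iff)
  also have "\<dots> = real (card H) * real g" by simp
  also have "\<dots> \<le> (2 * L * s) * g" using H by (intro mult_right_mono) auto
  also have "\<dots> = 2 * s * m * n" using g by (simp add: L_def)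
  finally show ?thesis .
qed

section \<open>Measures of intersections of intervals\<close>

definition oball :: "real \<Rightarrow> real \<Rightarrow> real set" where
  "oball c r = {c - r<..<c + r}"

lemma oball_iff: "x \<in> oball c r \<longleftrightarrow> \<bar>x - c\<bar> < r"
  by (auto simp: oball_def)

lemma oball_measurable [measurable]: "oball c r \<in> sets borel"
  by (simp add: oball_def)

lemma emeasure_oball_less_top [simp]: "emeasure lborel (oball c r) < top"
  by (cases "c - r \<le> c + r") (auto simp: oball_def emeasure_lborel_Ioo)

lemma measure_oball: "r \<ge> 0 \<Longrightarrow> measure lborel (oball c r) = 2 * r"
  by (simp add: oball_def measure_def emeasure_lborel_Ioo)

lemma emeasure_oball_Int_less_top [simp]: "emeasure lborel (oball c r \<inter> oball c' s) < top"
  by (rule le_less_trans[OF emeasure_mono emeasure_oball_less_top[of c r]]) auto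

text \<open>After a shift by c the variable u is the displacement from the first centre. A sum of
  overlaps over many pairs of centres can then be bounded by counting pairs for each fixed
  u.\<close>

lemma measure_oball_Int:
  "integrable lborel (\<lambda>u. indicator (oball 0 r) u * indicator (oball (c' - c) s) u :: real)"
  "measure lborel (oball c r \<inter> oball c' s) =
     (\<integral>u. indicator (oball 0 r) u * indicator (oball (c' - c) s) u \<partial>lborel)"
proof -
  show "integrable lborel (\<lambda>u. indicator (oball 0 r) u * indicator (oball (c' - c) s) u :: real)"
    unfolding indicator_inter_arith[symmetric] by (rule integrable_real_indicator) auto
  have "measure lborel (oball c r \<inter> oball c' s) =
      (\<integral>x. indicator (oball c r \<inter> oball c' s) x \<partial>lborel)"
    by simp
  also have "\<dots> = (\<integral>u. indicator (oball c r \<inter> oball c' s) (c + 1 * u) \<partial>lborel)"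
    by (subst lborel_integral_real_affine[of 1 _ c]) auto
  also have "\<dots> = (\<integral>u. indicator (oball 0 r) u * indicator (oball (c' - c) s) u \<partial>lborel)"
    by (intro Bochner_Integration.integral_cong) (auto simp: oball_iff indicator_def algebra_simps)
  finally show "measure lborel (oball c r \<inter> oball c' s) =
     (\<integral>u. indicator (oball 0 r) u * indicator (oball (c' - c) s) u \<partial>lborel)" .
qed

text \<open>The bound is the product of the total lengths 2 r m and 2 s n, as for independent
  events. For each displacement |u| < r there are at most 2 s m n pairs, and integration supplies 2
  r. The counting requires |u| < s, so the smaller radius is put first by symmetry.\<close>

lemma sum_measure_overlaps_le:
  fixes m n :: nat and r s :: real
  assumes "m > 0" "n > 0" "0 \<le> r" "0 \<le> s"
  shows "(\<Sum>(a,b)\<in>{(a,b) \<in> {1..m} \<times> {1..n}. a * n \<noteq> b * m}.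
            measure lborel (oball (real a / m) r \<inter> oball (real b / n) s)) \<le> 4 * r * s * m * n"
proof -
  have main: "(\<Sum>(a,b)\<in>{(a,b) \<in> {1..m} \<times> {1..n}. a * n \<noteq> b * m}.
            measure lborel (oball (real a / m) r \<inter> oball (real b / n) s)) \<le> 4 * r * s * m * n"
    if mn: "m > 0" "n > 0" and rs: "0 \<le> r" "r \<le> s" for m n :: nat and r s :: real
  proof -
    let ?P = "{(a,b) \<in> {1..m} \<times> {1..n}. a * n \<noteq> b * m}"
    have fin: "finite ?P" by (rule finite_subset[of _ "{1..m} \<times> {1..n}"]) auto
    let ?f = "\<lambda>p u. indicator (oball 0 r) u * indicator (oball (real (snd p) / n - real (fst p) / m) s) u :: real"
    have "(\<Sum>(a,b)\<in>?P. measure lborel (oball (real a / m) r \<inter> oball (real b / n) s))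
            = (\<Sum>p\<in>?P. \<integral>u. ?f p u \<partial>lborel)"
      by (intro sum.cong) (auto simp: measure_oball_Int)
    also have "\<dots> = (\<integral>u. (\<Sum>p\<in>?P. ?f p u) \<partial>lborel)"
      by (rule Bochner_Integration.integral_sum[symmetric]) (rule measure_oball_Int)
    also have "\<dots> \<le> (\<integral>u. (2 * s * m * n) * indicator (oball 0 r) u \<partial>lborel)"
    proof (rule integral_mono)
      show "integrable lborel (\<lambda>u. \<Sum>p\<in>?P. ?f p u)"
        by (intro Bochner_Integration.integrable_sum measure_oball_Int)
      show "integrable lborel (\<lambda>u. (2 * s * m * n) * indicator (oball 0 r) u :: real)"
        by (intro integrable_mult_right integrable_real_indicator) auto
      fix u :: real
      show "(\<Sum>p\<in>?P. ?f p u) \<le> (2 * s * m * n) * indicator (oball 0 r) u"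
      proof (cases "\<bar>u\<bar> < r")
        case True
        have "(\<Sum>p\<in>?P. ?f p u) = (\<Sum>p\<in>?P. indicator {p. \<bar>real (fst p) / m + u - real (snd p) / n\<bar> < s} p)"
          using True by (intro sum.cong) (auto simp: oball_iff indicator_def algebra_simps)
        also have "\<dots> = real (card (?P \<inter> {p. \<bar>real (fst p) / m + u - real (snd p) / n\<bar> < s}))"
          using fin by (simp only: indicator_def sum.If_cases) simp
        also have "?P \<inter> {p. \<bar>real (fst p) / m + u - real (snd p) / n\<bar> < s} =
            {(a,b) \<in> {1..m} \<times> {1..n}. a * n \<noteq> b * m \<and> \<bar>real a / m + u - real b / n\<bar> < s}"
          by auto
        also have "real (card \<dots>) \<le> 2 * s * m * n"
          using True rs by (intro card_fraction_pairs_le mn) auto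
        finally show ?thesis using True by (simp add: oball_iff)
      qed (simp add: oball_iff)
    qed
    also have "\<dots> = 4 * r * s * m * n"
      using rs by (simp add: measure_oball)
    finally show ?thesis .
  qed
  show ?thesis
  proof (cases "r \<le> s")
    case True thus ?thesis using main assms by blast
  next
    case False
    have "(\<Sum>(a,b)\<in>{(a,b) \<in> {1..m} \<times> {1..n}. a * n \<noteq> b * m}.
            measure lborel (oball (real a / m) r \<inter> oball (real b / n) s)) =
          (\<Sum>(b,a)\<in>{(b,a) \<in> {1..n} \<times> {1..m}. b * m \<noteq> a * n}.
            measure lborel (oball (real b / n) s \<inter> oball (real a / m) r))"
      by (rule sum.reindex_bij_witness[of _ prod.swap prod.swap]) (auto simp: Int_commute)
    also have "\<dots> \<le> 4 * s * r * n * m" using False assms by (intro main) auto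
    finally show ?thesis by (simp add: mult_ac)
  qed
qed

section \<open>The second moment\<close>

lemma sum_indicator_oball_le:
  fixes n :: nat and c x :: real
  assumes "n > 0" "c \<le> 1 / 2" "X \<subseteq> {1..n}"
  shows "(\<Sum>a\<in>X. indicator (oball (real a / n) (c / n)) x) \<le> (indicator {x. dist_int (real n * x) < c} x :: real)"
proof -
  have fin: "finite X" using assms(3) finite_subset by blast
  let ?C = "X \<inter> {a. x \<in> oball (real a / n) (c / n)}"
  have iff: "x \<in> oball (real a / n) (c / n) \<longleftrightarrow> \<bar>real n * x - real a\<bar> < c" for a :: nat
  proof -
    have "\<bar>x - real a / n\<bar> = \<bar>real n * x - real a\<bar> / n"
      using assms(1) by (simp add: field_simps abs_divide)
    thus ?thesis using assms(1) by (simp add: oball_iff divide_less_cancel)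
  qed
  have "(\<Sum>a\<in>X. indicator (oball (real a / n) (c / n)) x :: real) = real (card ?C)"
    using fin by (simp add: indicator_def sum.If_cases)
  also have "\<dots> \<le> indicator {x. dist_int (real n * x) < c} x"
  proof (cases "?C = {}")
    case False
    then obtain a where a: "a \<in> ?C" by auto
    have "?C \<subseteq> {a}"
    proof
      fix b assume "b \<in> ?C"
      with a have "\<bar>real n * x - real a\<bar> < c" "\<bar>real n * x - real b\<bar> < c" by (auto simp: iff)
      hence "\<bar>real b - real a\<bar> < 1" using assms(2) by linarith
      thus "b \<in> {a}" by auto
    qed
    hence "card ?C \<le> 1" using card_mono[of "{a}" ?C] by simp
    moreover have "dist_int (real n * x) < c"
      using a dist_int_le[of "real n * x" "int a"] by (auto simp: iff)
    ultimately show ?thesis by simp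
  qed simp
  finally show ?thesis .
qed

text \<open>Union bound: a discarded numerator is a multiple of its gcd with n, which is a divisor q
  > D of n, and {1..n} contains n / q multiples of q.\<close>

lemma card_gcd_le_ge:
  fixes n D :: nat
  assumes "n > 0"
  shows "real (card {a\<in>{1..n}. gcd a n \<le> D}) \<ge> real n * (1 - (\<Sum>q | q dvd n \<and> q > D. 1 / real q))"
proof -
  let ?Q = "{q. q dvd n \<and> q > D}"
  have finQ: "finite ?Q" using assms by simp
  have mult: "card {a\<in>{1..n}. q dvd a} = n div q" if "q dvd n" for q
  proof -
    have q: "q > 0" using that assms by (auto intro: Nat.gr0I)
    have "{a\<in>{1..n}. q dvd a} = (\<lambda>b. q * b) ` {1..n div q}"
    proof (intro set_eqI iffI)
      fix a assume "a \<in> {a\<in>{1..n}. q dvd a}"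
      then obtain b where b: "a = q * b" "1 \<le> a" "a \<le> n" by auto
      hence "b \<ge> 1" by (cases b) auto
      moreover have "b \<le> n div q" using b q by (simp add: less_eq_div_iff_mult_less_eq mult.commute)
      ultimately show "a \<in> (\<lambda>b. q * b) ` {1..n div q}" using b by auto
    next
      fix a assume "a \<in> (\<lambda>b. q * b) ` {1..n div q}"
      then obtain b where b: "a = q * b" "1 \<le> b" "b \<le> n div q" by (auto simp only: atLeastAtMost_iff)
      hence "q * b \<le> n" using q by (simp add: less_eq_div_iff_mult_less_eq mult.commute)
      thus "a \<in> {a\<in>{1..n}. q dvd a}" using b q by auto
    qed
    thus ?thesis using q by (simp add: card_image inj_on_def)
  qed
  have "{1..n} \<subseteq> {a\<in>{1..n}. gcd a n \<le> D} \<union> (\<Union>q\<in>?Q. {a\<in>{1..n}. q dvd a})"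
    by auto (metis gcd_dvd1 gcd_dvd2 not_less)
  hence "card {1..n} \<le> card ({a\<in>{1..n}. gcd a n \<le> D} \<union> (\<Union>q\<in>?Q. {a\<in>{1..n}. q dvd a}))"
    using finQ by (intro card_mono) auto
  also have "\<dots> \<le> card {a\<in>{1..n}. gcd a n \<le> D} + card (\<Union>q\<in>?Q. {a\<in>{1..n}. q dvd a})"
    by (rule card_Un_le)
  also have "card (\<Union>q\<in>?Q. {a\<in>{1..n}. q dvd a}) \<le> (\<Sum>q\<in>?Q. card {a\<in>{1..n}. q dvd a})"
    by (rule card_UN_le[OF finQ])
  also have "(\<Sum>q\<in>?Q. card {a\<in>{1..n}. q dvd a}) = (\<Sum>q\<in>?Q. n div q)"
    by (intro sum.cong refl mult) auto
  finally have "n \<le> card {a\<in>{1..n}. gcd a n \<le> D} + (\<Sum>q\<in>?Q. n div q)" by simp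
  hence "real n \<le> real (card {a\<in>{1..n}. gcd a n \<le> D}) + (\<Sum>q\<in>?Q. real (n div q))"
    by (metis of_nat_le_iff of_nat_add of_nat_sum)
  also have "(\<Sum>q\<in>?Q. real (n div q)) = real n * (\<Sum>q\<in>?Q. 1 / real q)"
    unfolding sum_distrib_left by (intro sum.cong) (auto simp: real_of_nat_div)
  finally show ?thesis by (simp add: algebra_simps)
qed

text \<open>Numerators sharing a divisor larger than \<open>D\<close> with the denominator are discarded. This costs
  almost no measure, but a given fraction then occurs with at most \<open>D\<close> denominators, which keeps the
  contribution of coinciding fractions to the second moment linear in \<open>V\<close>.\<close>

lemma card_equal_fractions_le:
  fixes a n D :: nat
  assumes "n > 0" "a > 0" "finite X"
  shows "card {(m,b) \<in> (SIGMA m:X. {b\<in>{1..m}. gcd b m \<le> D}). a * m = b * n} \<le> D"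
    (is "card ?P \<le> D")
proof -
  define g where "g = gcd a n"
  have g: "g > 0" using assms by (simp add: g_def)
  obtain a' n' where an: "a = a' * g" "n = n' * g" "coprime a' n'"
    using g unfolding g_def by (metis gcd_coprime_exists less_numeral_extra(3) )
  \<comment> \<open>All these fractions have the same lowest terms a' / n', so (m, b) is (s n', s
    a') with s = gcd b m <= D.\<close>
  have sub: "?P \<subseteq> (\<lambda>s. (s * n', s * a')) ` {1..D}"
  proof clarify
    fix m b assume mb: "m \<in> X" "b \<in> {1..m}" "gcd b m \<le> D" "a * m = b * n"
    define s where "s = gcd b m"
    have s: "s > 0" using mb by (simp add: s_def)
    obtain b' m' where bm: "b = b' * s" "m = m' * s" "coprime b' m'"
      using s unfolding s_def by (metis gcd_coprime_exists less_numeral_extra(3))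
    have "a' * m' = b' * n'" using mb(4) g s by (simp add: an bm)
    hence "a' = b' \<and> m' = n'"
      using an(3) bm(3) by (simp add: coprime_crossproduct_nat mult.commute)
    hence eq: "a' = b'" "m' = n'" by auto
    show "(m, b) \<in> (\<lambda>s. (s * n', s * a')) ` {1..D}"
    proof (rule image_eqI)
      show "(m, b) = (s * n', s * a')" by (simp only: bm(1,2) eq mult.commute)
      show "s \<in> {1..D}" using s mb(3) by (simp add: s_def[symmetric] Suc_le_eq)
    qed
  qed
  have "card ?P \<le> card ((\<lambda>s. (s * n', s * a')) ` {1..D})" by (rule card_mono[OF _ sub]) auto
  also have "\<dots> \<le> D" using card_image_le[of "{1..D}" "(\<lambda>s. (s * n', s * a'))"] by simp
  finally show ?thesis .
qed

text \<open>Chebyshev's inequality for the number T of intervals containing x, whose mean is nearly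
  2 V: where T < V, the deviation from 2 V is at least V. Pairs of distinct fractions contribute at
  most (2 V)^2, which cancels against the mean; there remain 2 D V from coinciding fractions and 8 V
  e from discarded numerators.\<close>

lemma second_moment:
  fixes A :: "nat set" and \<Phi> :: "nat \<Rightarrow> real" and D :: nat and V e :: real
  assumes A: "finite A" "\<And>n. n \<in> A \<Longrightarrow> n > D" and D: "D > 0"
    and \<Phi>: "\<And>n. n \<in> A \<Longrightarrow> 0 \<le> \<Phi> n \<and> \<Phi> n \<le> 1 / 2"
  defines "V \<equiv> \<Sum>n\<in>A. \<Phi> n"
    and "e \<equiv> \<Sum>n\<in>A. \<Phi> n * (\<Sum>q | q dvd n \<and> q > D. 1 / real q)"
  assumes V: "V > 0"
  obtains B where "B \<in> sets lborel" "B \<subseteq> {0..1}" "measure lborel B \<le> (2 * real D * V + 8 * V * e) / V\<^sup>2"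
    "\<And>x. x \<in> {0..1} - B \<Longrightarrow> V \<le> real (card {n\<in>A. dist_int (real n * x) < \<Phi> n})"
proof -
  define I where "I = (SIGMA n:A. {a\<in>{1..n}. gcd a n \<le> D})"
  define U where "U = (\<lambda>(n,a). oball (real a / real n) (\<Phi> n / real n))"
  define T where "T = (\<lambda>x. \<Sum>i\<in>I. indicator (U i) x :: real)"
  have finI: "finite I" using A by (auto simp: I_def)
  have sumI: "(\<Sum>i\<in>I. f i) = (\<Sum>n\<in>A. \<Sum>a\<in>{a\<in>{1..n}. gcd a n \<le> D}. f (n, a))" for f :: "nat \<times> nat \<Rightarrow> real"
    unfolding I_def using A by (subst sum.Sigma) auto
  have Apos: "n > 0" if "n \<in> A" for n using A(2)[OF that] by simp
  have U_meas [measurable]: "U i \<in> sets borel" for i by (auto simp: U_def split: prod.splits)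
  have T_meas [measurable]: "T \<in> borel_measurable borel" unfolding T_def by measurable
  have T_nonneg: "T x \<ge> 0" for x by (simp add: T_def sum_nonneg)
  have U_fin: "emeasure lborel (U i) < top" for i by (auto simp: U_def split: prod.splits)
  have U2_fin: "emeasure lborel (U i \<inter> U j) < top" for i j
    by (rule le_less_trans[OF emeasure_mono U_fin[of i]]) auto
  have mU: "measure lborel (U (n,a)) = 2 * \<Phi> n / n" if "n \<in> A" for n a
    using \<Phi>[OF that] by (simp add: U_def measure_oball)

  have T_le: "T x \<le> real (card {n\<in>A. dist_int (real n * x) < \<Phi> n})" for x
  proof -
    have "T x = (\<Sum>n\<in>A. \<Sum>a\<in>{a\<in>{1..n}. gcd a n \<le> D}. indicator (oball (real a / n) (\<Phi> n / n)) x)"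
      unfolding T_def sumI by (simp add: U_def)
    also have "\<dots> \<le> (\<Sum>n\<in>A. indicator {x. dist_int (real n * x) < \<Phi> n} x)"
      using \<Phi> Apos by (intro sum_mono sum_indicator_oball_le) auto
    also have "\<dots> = real (card {n\<in>A. dist_int (real n * x) < \<Phi> n})"
      using A(1) by (simp add: indicator_def sum.If_cases Int_def)
    finally show ?thesis .
  qed

  \<comment> \<open>n > D excludes the numerator a = n, whose gcd with n is n. So all intervals lie
    inside {0..1} and nothing wraps around.\<close>
  have U_sub: "U i \<subseteq> {0..1}" if i: "i \<in> I" for i
  proof -
    obtain n a where na: "i = (n,a)" "n \<in> A" "1 \<le> a" "a \<le> n" "gcd a n \<le> D" using i by (auto simp: I_def)
    have "a \<noteq> n" using A(2)[of n] na by auto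
    hence an: "real a + 1 \<le> real n" using na by linarith
    have n: "real n > 0" using Apos na by simp
    have \<Phi>n: "\<Phi> n / n \<le> (1/2) / n" using \<Phi> na n by (intro divide_right_mono) auto
    have lo: "1 / n \<le> real a / n" using na n by (intro divide_right_mono) auto
    have hi: "real a / n \<le> (real n - 1) / n" using an n by (intro divide_right_mono) auto
    have "\<Phi> n / n \<le> real a / n" using \<Phi>n lo n by (simp add: field_simps)
    moreover have "real a / n + \<Phi> n / n \<le> 1"
    proof -
      have "real a + \<Phi> n \<le> real n" using \<Phi>[OF na(2)] an by linarith
      thus ?thesis using n by (simp add: add_divide_distrib[symmetric])
    qed
    ultimately show ?thesis unfolding na U_def oball_def by auto
  qed

  have T_int: "integrable lborel T"
    unfolding T_def using U_fin by (intro Bochner_Integration.integrable_sum integrable_real_indicator) auto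
  have IT: "(\<integral>x. T x \<partial>lborel) \<ge> 2 * V - 2 * e"
  proof -
    have "(\<integral>x. T x \<partial>lborel) = (\<Sum>i\<in>I. measure lborel (U i))"
      unfolding T_def using U_fin
      by (subst Bochner_Integration.integral_sum) (auto intro!: integrable_real_indicator)
    also have "\<dots> = (\<Sum>n\<in>A. \<Sum>a\<in>{a\<in>{1..n}. gcd a n \<le> D}. 2 * \<Phi> n / n)"
      unfolding sumI by (intro sum.cong refl mU)
    also have "\<dots> = (\<Sum>n\<in>A. (2 * \<Phi> n / n) * real (card {a\<in>{1..n}. gcd a n \<le> D}))"
      by (simp add: mult.commute)
    also have "\<dots> \<ge> (\<Sum>n\<in>A. (2 * \<Phi> n / n) * (real n * (1 - (\<Sum>q | q dvd n \<and> q > D. 1 / real q))))"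
      using \<Phi> Apos by (intro sum_mono mult_left_mono card_gcd_le_ge) auto
    also have "(\<Sum>n\<in>A. (2 * \<Phi> n / n) * (real n * (1 - (\<Sum>q | q dvd n \<and> q > D. 1 / real q))))
        = (\<Sum>n\<in>A. 2 * \<Phi> n - 2 * (\<Phi> n * (\<Sum>q | q dvd n \<and> q > D. 1 / real q)))"
    proof (intro sum.cong refl)
      fix n assume "n \<in> A"
      hence "real n \<noteq> 0" using Apos by auto
      hence eq: "(2 * \<Phi> n / n) * (real n * s) = 2 * \<Phi> n * s" for s by simp
      show "(2 * \<Phi> n / n) * (real n * (1 - (\<Sum>q | q dvd n \<and> q > D. 1 / real q)))
          = 2 * \<Phi> n - 2 * (\<Phi> n * (\<Sum>q | q dvd n \<and> q > D. 1 / real q))"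
        unfolding eq by (simp only: right_diff_distrib mult_1_right mult.assoc)
    qed
    also have "\<dots> = 2 * V - 2 * e"
      by (simp add: V_def e_def sum_subtractf sum_distrib_left)
    finally show ?thesis .
  qed

  have T2_eq: "T x * T x = (\<Sum>i\<in>I. \<Sum>j\<in>I. indicator (U i \<inter> U j) x)" for x
    by (simp add: T_def sum_product indicator_inter_arith)
  have T2_int: "integrable lborel (\<lambda>x. T x * T x)"
    unfolding T2_eq using U2_fin by (intro Bochner_Integration.integrable_sum integrable_real_indicator) auto
  have IT2: "(\<integral>x. T x * T x \<partial>lborel) \<le> 4 * V\<^sup>2 + 2 * real D * V"
  proof -
    let ?M = "\<lambda>i j. measure lborel (U i \<inter> U j)"
    let ?E = "\<lambda>i j. snd i * fst j = snd j * fst i"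
    have "(\<integral>x. T x * T x \<partial>lborel) = (\<Sum>i\<in>I. \<Sum>j\<in>I. ?M i j)"
      unfolding T2_eq using U2_fin
      by (subst Bochner_Integration.integral_sum, intro Bochner_Integration.integrable_sum integrable_real_indicator)
         (auto intro!: integrable_real_indicator sum.cong simp: Bochner_Integration.integral_sum)
    also have "\<dots> = (\<Sum>i\<in>I. (\<Sum>j | j \<in> I \<and> ?E i j. ?M i j) + (\<Sum>j | j \<in> I \<and> \<not> ?E i j. ?M i j))"
      using finI by (intro sum.cong refl) (subst sum.union_disjoint[symmetric], auto intro!: sum.cong)
    also have "\<dots> = (\<Sum>i\<in>I. \<Sum>j | j \<in> I \<and> ?E i j. ?M i j) + (\<Sum>i\<in>I. \<Sum>j | j \<in> I \<and> \<not> ?E i j. ?M i j)"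
      by (rule sum.distrib)
    also have "(\<Sum>i\<in>I. \<Sum>j | j \<in> I \<and> ?E i j. ?M i j) \<le> 2 * real D * V"
    proof -
      have "(\<Sum>j | j \<in> I \<and> ?E i j. ?M i j) \<le> D * (2 * \<Phi> (fst i) / real (fst i))" if i: "i \<in> I" for i
      proof -
        have iA: "fst i \<in> A" "snd i > 0" using i by (auto simp: I_def)
        have "(\<Sum>j | j \<in> I \<and> ?E i j. ?M i j) \<le> (\<Sum>j | j \<in> I \<and> ?E i j. 2 * \<Phi> (fst i) / real (fst i))"
        proof (intro sum_mono)
          fix j
          have "?M i j \<le> measure lborel (U i)"
            using U_fin by (intro measure_mono_fmeasurable) (auto simp: fmeasurable_def)
          thus "?M i j \<le> 2 * \<Phi> (fst i) / real (fst i)" using mU[OF iA(1), of "snd i"] by simp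
        qed
        also have "\<dots> = real (card {j. j \<in> I \<and> ?E i j}) * (2 * \<Phi> (fst i) / real (fst i))" by simp
        also have "\<dots> \<le> D * (2 * \<Phi> (fst i) / real (fst i))"
        proof (intro mult_right_mono)
          have "{j. j \<in> I \<and> ?E i j} = {(m,b) \<in> (SIGMA m:A. {b\<in>{1..m}. gcd b m \<le> D}). snd i * m = b * fst i}"
            by (auto simp: I_def)
          thus "real (card {j. j \<in> I \<and> ?E i j}) \<le> real D"
            using card_equal_fractions_le[OF Apos[OF iA(1)] iA(2) A(1), of D] by simp
        qed (use \<Phi>[OF iA(1)] in auto)
        finally show ?thesis .
      qed
      hence "(\<Sum>i\<in>I. \<Sum>j | j \<in> I \<and> ?E i j. ?M i j) \<le> (\<Sum>i\<in>I. D * (2 * \<Phi> (fst i) / real (fst i)))"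
        by (rule sum_mono)
      also have "\<dots> = (\<Sum>n\<in>A. \<Sum>a\<in>{a\<in>{1..n}. gcd a n \<le> D}. D * (2 * \<Phi> n / n))"
        unfolding sumI by simp
      also have "\<dots> \<le> (\<Sum>n\<in>A. \<Sum>a\<in>{1..n}. D * (2 * \<Phi> n / n))"
        using \<Phi> by (intro sum_mono sum_mono2) auto
      also have "\<dots> = (\<Sum>n\<in>A. 2 * D * \<Phi> n)"
        using Apos by (intro sum.cong) auto
      also have "\<dots> = 2 * real D * V" by (simp add: V_def sum_distrib_left)
      finally show ?thesis .
    qed
    also have "(\<Sum>i\<in>I. \<Sum>j | j \<in> I \<and> \<not> ?E i j. ?M i j) \<le> 4 * V\<^sup>2"
    proof -
      let ?S = "\<lambda>m n. {(a,b) \<in> {1..m} \<times> {1..n}. a * n \<noteq> b * m}"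
      let ?m = "\<lambda>m n. (\<lambda>(a,b). ?M (m,a) (n,b))"
      have finS: "finite (?S m n)" for m n :: nat by (rule finite_subset[of _ "{1..m} \<times> {1..n}"]) auto
      have "(\<Sum>i\<in>I. \<Sum>j | j \<in> I \<and> \<not> ?E i j. ?M i j) =
          (\<Sum>(i,j)\<in>(SIGMA i:I. {j. j \<in> I \<and> \<not> ?E i j}). ?M i j)"
        using finI by (subst sum.Sigma) auto
      \<comment> \<open>The pairs are regrouped by their two denominators; then the gcd conditions
        are dropped, which only enlarges a sum of nonnegative terms.\<close>
      also have "\<dots> = (\<Sum>(p,s)\<in>(SIGMA p:A\<times>A. {s \<in> ?S (fst p) (snd p). gcd (fst s) (fst p) \<le> D \<and> gcd (snd s) (snd p) \<le> D}). ?m (fst p) (snd p) s)"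
        by (rule sum.reindex_bij_witness[of _ "\<lambda>((m,n),(a,b)). ((m,a),(n,b))" "\<lambda>((m,a),(n,b)). ((m,n),(a,b))"])
           (auto simp: I_def)
      also have "\<dots> \<le> (\<Sum>(p,s)\<in>(SIGMA p:A\<times>A. ?S (fst p) (snd p)). ?m (fst p) (snd p) s)"
        using A finS by (intro sum_mono2 finite_SigmaI) auto
      also have "\<dots> = (\<Sum>p\<in>A\<times>A. \<Sum>s\<in>?S (fst p) (snd p). ?m (fst p) (snd p) s)"
        using A finS by (subst sum.Sigma) auto
      also have "\<dots> \<le> (\<Sum>p\<in>A\<times>A. 4 * \<Phi> (fst p) * \<Phi> (snd p))"
      proof (intro sum_mono)
        fix p assume "p \<in> A \<times> A"
        then obtain m n where mn: "p = (m,n)" "m \<in> A" "n \<in> A" by auto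
        have "(\<Sum>s\<in>?S m n. ?m m n s) \<le> 4 * (\<Phi> m / m) * (\<Phi> n / n) * m * n"
          unfolding U_def prod.case using mn \<Phi> Apos by (intro sum_measure_overlaps_le) auto
        also have "\<dots> = 4 * \<Phi> m * \<Phi> n" using Apos mn by auto
        finally show "(\<Sum>s\<in>?S (fst p) (snd p). ?m (fst p) (snd p) s) \<le> 4 * \<Phi> (fst p) * \<Phi> (snd p)"
          by (simp add: mn)
      qed
      also have "\<dots> = (\<Sum>m\<in>A. \<Sum>n\<in>A. 4 * \<Phi> m * \<Phi> n)"
        by (simp add: sum.cartesian_product case_prod_unfold)
      also have "\<dots> = 4 * V\<^sup>2"
        unfolding V_def power2_eq_square sum_product by (simp add: sum_distrib_left mult.assoc)
      finally show ?thesis .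
    qed
    finally show ?thesis by simp
  qed

  define B where "B = {x\<in>{0..1}. T x < V}"
  have B_sets: "B \<in> sets lborel" unfolding B_def by measurable
  have B_fin: "emeasure lborel B < top"
    by (rule le_less_trans[OF emeasure_mono[of B "{0..1}"]]) (auto simp: B_def)
  have T_out: "T x = 0" if "x \<notin> {0..1}" for x
    unfolding T_def
  proof (intro sum.neutral ballI)
    fix i assume "i \<in> I"
    hence "x \<notin> U i" using U_sub that by blast
    thus "indicator (U i) x = 0" by simp
  qed
  have "measure lborel B * V\<^sup>2 = (\<integral>x. V\<^sup>2 * indicator B x \<partial>lborel)" by simp
  also have "\<dots> \<le> (\<integral>x. T x * T x - 4 * V * T x + 4 * V\<^sup>2 * indicator {0..1} x \<partial>lborel)"
  proof (rule integral_mono)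
    show "integrable lborel (\<lambda>x. V\<^sup>2 * indicator B x)"
      using B_sets B_fin by (intro integrable_mult_right integrable_real_indicator) auto
    show "integrable lborel (\<lambda>x. T x * T x - 4 * V * T x + 4 * V\<^sup>2 * indicator {0..1} x)"
      by (intro Bochner_Integration.integrable_add Bochner_Integration.integrable_diff T2_int
          integrable_mult_right T_int integrable_real_indicator) auto
    fix x :: real
    show "V\<^sup>2 * indicator B x \<le> T x * T x - 4 * V * T x + 4 * V\<^sup>2 * indicator {0..1} x"
    proof (cases "x \<in> {0..1}")
      case True
      have "T x * T x - 4 * V * T x + 4 * V\<^sup>2 = (2 * V - T x)\<^sup>2"
        by (simp add: power2_eq_square algebra_simps)
      moreover have "V\<^sup>2 \<le> (2 * V - T x)\<^sup>2" if "T x < V"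
        using that V by (intro power_mono) auto
      ultimately show ?thesis using True by (auto simp: B_def indicator_def)
    qed (auto simp: B_def T_out)
  qed
  also have "\<dots> = (\<integral>x. T x * T x \<partial>lborel) - 4 * V * (\<integral>x. T x \<partial>lborel) + 4 * V\<^sup>2"
    using T2_int T_int by (simp add: Bochner_Integration.integral_add Bochner_Integration.integral_diff)
  also have "\<dots> \<le> (4 * V\<^sup>2 + 2 * real D * V) - 4 * V * (2 * V - 2 * e) + 4 * V\<^sup>2"
    using IT IT2 V by (intro add_mono diff_mono mult_left_mono) auto
  also have "\<dots> = 2 * real D * V + 8 * V * e" by (simp add: power2_eq_square algebra_simps)
  finally have "measure lborel B \<le> (2 * real D * V + 8 * V * e) / V\<^sup>2"
    using V by (simp add: field_simps)
  moreover have "V \<le> real (card {n\<in>A. dist_int (real n * x) < \<Phi> n})" if "x \<in> {0..1} - B" for x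
    using that T_le[of x] by (auto simp: B_def)
  moreover have "B \<subseteq> {0..1}" by (auto simp: B_def)
  ultimately show ?thesis using that[OF B_sets] by blast
qed

section \<open>Almost everywhere counting\<close>

lemma sum_dyadic_blocks:
  fixes f :: "nat \<Rightarrow> real"
  assumes "a \<le> b"
  shows "(\<Sum>n\<in>{2 ^ a..<2 ^ b}. f n) = (\<Sum>j\<in>{a..<b}. \<Sum>n\<in>{2 ^ j..<2 ^ Suc j}. f n)"
  using assms
proof (induction b rule: dec_induct)
  case (step b)
  have "(2::nat) ^ a \<le> 2 ^ b" "(2::nat) ^ b \<le> 2 ^ Suc b" using step by (auto intro: power_increasing)
  hence "(\<Sum>n\<in>{2 ^ a..<2 ^ Suc b}. f n) = (\<Sum>n\<in>{2 ^ a..<2 ^ b}. f n) + (\<Sum>n\<in>{2 ^ b..<2 ^ Suc b}. f n)"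
    by (rule sum.atLeastLessThan_concat[symmetric])
  thus ?case using step by simp
qed simp

text \<open>With D = t^2 and V >= 16^t / 2 the exceptional sets have measure O(t^2 / 16^t + 1 /
  t^2), which is summable in t.\<close>

lemma AE_count_ge_along_powers:
  fixes \<Phi> :: "nat \<Rightarrow> real" and j0 :: nat
  defines "v \<equiv> \<lambda>j. \<Sum>n\<in>{2 ^ j..<2 ^ Suc j}. \<Phi> n"
  assumes \<Phi>: "\<And>n. n \<ge> 1 \<Longrightarrow> 0 \<le> \<Phi> n \<and> \<Phi> n \<le> 1 / 2"
    and e: "\<And>(j::nat) (D::nat). j \<ge> j0 \<Longrightarrow> D > 0 \<Longrightarrow> D \<le> j\<^sup>2 \<Longrightarrow>
       (\<Sum>n\<in>{2 ^ j..<2 ^ Suc j}. \<Phi> n * (\<Sum>q | q dvd n \<and> q > D. 1 / real q)) \<le> 8 / D * v j"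
    and m: "\<And>t. 16 ^ t \<le> (\<Sum>j<m t. v j)"
  shows "AE x in lborel. x \<in> {0..1} \<longrightarrow> (\<forall>\<^sub>F t in sequentially.
      16 ^ t / 2 \<le> real (card {n\<in>{1..<2 ^ m t}. dist_int (real n * x) < \<Phi> n}))"
proof -
  have v_nonneg: "v j \<ge> 0" for j
    unfolding v_def
  proof (intro sum_nonneg)
    fix n :: nat assume "n \<in> {2 ^ j..<2 ^ Suc j}"
    moreover have "(1::nat) \<le> 2 ^ j" by simp
    ultimately have "n \<ge> 1" unfolding atLeastLessThan_iff by linarith
    thus "\<Phi> n \<ge> 0" using \<Phi> by blast
  qed
  have v_le: "v j \<le> 2 ^ j / 2" for j
  proof -
    have "v j \<le> real (card {2 ^ j..<2 ^ Suc j :: nat}) * (1 / 2)"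
      unfolding v_def
    proof (intro sum_bounded_above)
      fix n :: nat assume "n \<in> {2 ^ j..<2 ^ Suc j}"
      moreover have "(1::nat) \<le> 2 ^ j" by simp
      ultimately have "n \<ge> 1" unfolding atLeastLessThan_iff by linarith
      thus "\<Phi> n \<le> 1 / 2" using \<Phi> by blast
    qed
    thus ?thesis by simp
  qed
  have V_le: "(\<Sum>j<a. v j) \<le> 2 ^ a / 2" for a
  proof (induction a)
    case (Suc a)
    show ?case using Suc v_le[of a] by simp
  qed simp
  \<comment> \<open>Starting at block 2 t + j0 ensures n > t^2 and j >= t, as the second moment and
    the divisor bound with D = t^2 demand. For t >= j0 the omitted blocks weigh at most 2^(2 t + j0)
    / 2 <= 16^t / 2, so half of 16^t remains.\<close>
  define a where "a = (\<lambda>t. 2 * t + j0)"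
  have am: "a t \<le> m t" and V_ge: "16 ^ t / 2 \<le> (\<Sum>j\<in>{a t..<m t}. v j)" if t: "t \<ge> j0" for t
  proof -
    have "(2::real) ^ a t = 4 ^ t * 2 ^ j0" by (simp add: a_def power_add power_mult)
    also have "\<dots> \<le> 4 ^ t * 2 ^ t" using t by (intro mult_left_mono power_increasing) auto
    also have "\<dots> = 8 ^ t" by (simp flip: power_mult_distrib)
    also have "\<dots> \<le> 16 ^ t" by (intro power_mono) auto
    finally have le: "(\<Sum>j<a t. v j) \<le> 16 ^ t / 2" using V_le[of "a t"] by linarith
    have "\<not> m t < a t"
    proof
      assume "m t < a t"
      hence "(\<Sum>j<m t. v j) \<le> (\<Sum>j<a t. v j)" using v_nonneg by (intro sum_mono2) auto
      moreover have "(16::real) ^ t > 0" by simp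
      ultimately show False using le m[of t] by linarith
    qed
    thus am: "a t \<le> m t" by simp
    have "(\<Sum>j<m t. v j) = (\<Sum>j<a t. v j) + (\<Sum>j\<in>{a t..<m t}. v j)"
      using am by (simp add: lessThan_atLeast0 sum.atLeastLessThan_concat)
    thus "16 ^ t / 2 \<le> (\<Sum>j\<in>{a t..<m t}. v j)" using le m[of t] by linarith
  qed
  define T0 where "T0 = max j0 1"
  define Q where "Q = (\<lambda>t B. B \<in> sets lborel \<and> B \<subseteq> {0..1} \<and>
      measure lborel B \<le> 4 / 4 ^ t + 64 * inverse (real t ^ 2) \<and>
      (\<forall>x\<in>{0..1} - B. 16 ^ t / 2 \<le> real (card {n\<in>{1..<2 ^ m t}. dist_int (real n * x) < \<Phi> n})))"
  have Q_ex: "\<exists>B. Q t B" if t: "t \<ge> T0" for t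
  proof -
    have t1: "t \<ge> j0" "t \<ge> 1" using t by (auto simp: T0_def)
    let ?A = "{2 ^ a t..<2 ^ m t} :: nat set"
    let ?V = "\<Sum>n\<in>?A. \<Phi> n"
    let ?e = "\<Sum>n\<in>?A. \<Phi> n * (\<Sum>q | q dvd n \<and> q > t\<^sup>2. 1 / real q)"
    have V_eq: "?V = (\<Sum>j\<in>{a t..<m t}. v j)"
      unfolding v_def by (rule sum_dyadic_blocks[OF am[OF t1(1)]])
    have p16: "(16::real) ^ t > 0" by simp
    have V: "?V \<ge> 16 ^ t / 2" using V_ge[OF t1(1)] V_eq by simp
    have V_pos: "?V > 0" using V p16 by linarith
    have "?e = (\<Sum>j\<in>{a t..<m t}. \<Sum>n\<in>{2 ^ j..<2 ^ Suc j}. \<Phi> n * (\<Sum>q | q dvd n \<and> q > t\<^sup>2. 1 / real q))"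
      by (rule sum_dyadic_blocks[OF am[OF t1(1)]])
    also have "\<dots> \<le> (\<Sum>j\<in>{a t..<m t}. 8 / real (t\<^sup>2) * v j)"
    proof (rule sum_mono)
      fix j assume "j \<in> {a t..<m t}"
      hence "j0 \<le> j" "t\<^sup>2 \<le> j\<^sup>2" by (auto simp: a_def intro: power_mono)
      moreover have "0 < t\<^sup>2" using t1 by simp
      ultimately show "(\<Sum>n\<in>{2 ^ j..<2 ^ Suc j}. \<Phi> n * (\<Sum>q | q dvd n \<and> q > t\<^sup>2. 1 / real q)) \<le>
          8 / real (t\<^sup>2) * v j" by (intro e)
    qed
    also have "\<dots> = 8 / real (t\<^sup>2) * ?V" by (simp only: V_eq sum_distrib_left)
    finally have e_le: "?e \<le> 8 / real (t\<^sup>2) * ?V" .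
    obtain B where B: "B \<in> sets lborel" "B \<subseteq> {0..1}"
      "measure lborel B \<le> (2 * real (t\<^sup>2) * ?V + 8 * ?V * ?e) / ?V\<^sup>2"
      "\<And>x. x \<in> {0..1} - B \<Longrightarrow> ?V \<le> real (card {n\<in>?A. dist_int (real n * x) < \<Phi> n})"
    proof (rule second_moment[of ?A "t\<^sup>2" \<Phi>])
      have "t < 2 ^ t" by (rule less_exp)
      hence "t\<^sup>2 < (2 ^ t)\<^sup>2" by (intro power_strict_mono) auto
      also have "((2::nat) ^ t)\<^sup>2 = 2 ^ (2 * t)" by (simp add: power_mult[symmetric] mult.commute)
      also have "\<dots> \<le> 2 ^ a t" by (intro power_increasing) (auto simp: a_def)
      finally have lt: "t\<^sup>2 < 2 ^ a t" .
      show gt: "t\<^sup>2 < n" if "n \<in> ?A" for n using lt that unfolding atLeastLessThan_iff by linarith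
      show "0 \<le> \<Phi> n \<and> \<Phi> n \<le> 1 / 2" if "n \<in> ?A" for n
        using \<Phi>[of n] gt[OF that] by linarith
    qed (use t1 V_pos in auto)
    have "measure lborel B \<le> (2 * real (t\<^sup>2) * ?V + 8 * ?V * (8 / real (t\<^sup>2) * ?V)) / ?V\<^sup>2"
      using B(3) e_le V_pos by (elim order.trans) (intro divide_right_mono add_left_mono mult_left_mono, auto)
    also have "\<dots> = 2 * real (t\<^sup>2) / ?V + 64 * inverse (real t ^ 2)"
      using V_pos t1 by (simp add: power2_eq_square field_simps)
    also have "2 * real (t\<^sup>2) / ?V \<le> 2 * 4 ^ t / (16 ^ t / 2)"
    proof (intro frac_le mult_left_mono V)
      have "real t ^ 2 \<le> (2 ^ t) ^ 2" by (intro power_mono) auto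
      also have "((2::real) ^ t)\<^sup>2 = 4 ^ t" by (simp add: power2_eq_square flip: power_mult_distrib)
      finally show "real (t\<^sup>2) \<le> 4 ^ t" by simp
    qed auto
    also have "2 * 4 ^ t / (16 ^ t / 2) = 4 / (4::real) ^ t"
      using power_mult_distrib[of "4::real" 4 t] by simp
    finally have meas: "measure lborel B \<le> 4 / 4 ^ t + 64 * inverse (real t ^ 2)" by simp
    have "16 ^ t / 2 \<le> real (card {n\<in>{1..<2 ^ m t}. dist_int (real n * x) < \<Phi> n})" if x: "x \<in> {0..1} - B" for x
    proof -
      have "?A \<subseteq> {1..<2 ^ m t}" by (simp add: ivl_subset Suc_le_eq)
      hence "{n\<in>?A. dist_int (real n * x) < \<Phi> n} \<subseteq> {n\<in>{1..<2 ^ m t}. dist_int (real n * x) < \<Phi> n}"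
        by blast
      hence "card {n\<in>?A. dist_int (real n * x) < \<Phi> n} \<le> card {n\<in>{1..<2 ^ m t}. dist_int (real n * x) < \<Phi> n}"
        by (intro card_mono) auto
      thus ?thesis using B(4)[OF x] V by linarith
    qed
    thus ?thesis unfolding Q_def using B(1,2) meas by blast
  qed
  define B where "B = (\<lambda>t. SOME B. Q t B)"
  have "Q t (B t)" if "t \<ge> T0" for t
    unfolding B_def using Q_ex[OF that] by (rule someI_ex)
  hence B: "\<And>t. t \<ge> T0 \<Longrightarrow> B t \<in> sets lborel" "\<And>t. t \<ge> T0 \<Longrightarrow> B t \<subseteq> {0..1}"
    "\<And>t. t \<ge> T0 \<Longrightarrow> measure lborel (B t) \<le> 4 / 4 ^ t + 64 * inverse (real t ^ 2)"
    "\<And>t x. t \<ge> T0 \<Longrightarrow> x \<in> {0..1} - B t \<Longrightarrow>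
      16 ^ t / 2 \<le> real (card {n\<in>{1..<2 ^ m t}. dist_int (real n * x) < \<Phi> n})"
    unfolding Q_def by blast+
  define C where "C = (\<lambda>t. B (t + T0))"
  have "AE x in lborel. eventually (\<lambda>t. x \<in> space lborel - C t) sequentially"
  proof (rule borel_cantelli_AE1)
    show "C t \<in> sets lborel" for t using B(1) by (simp add: C_def)
    show "emeasure lborel (C t) < \<infinity>" for t
      using B(2)[of "t + T0"] by (intro le_less_trans[OF emeasure_mono[of "C t" "{0..1}"]]) (auto simp: C_def)
    have "summable (\<lambda>t. 4 * (1 / 4 :: real) ^ t + 64 * inverse (real t ^ 2))"
      by (intro summable_add summable_mult summable_geometric inverse_power_summable) auto
    hence "summable (\<lambda>t. 4 / 4 ^ t + 64 * inverse (real t ^ 2))" by (simp add: power_divide)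
    hence "summable (\<lambda>t. 4 / 4 ^ (t + T0) + 64 * inverse (real (t + T0) ^ 2))"
      by (rule summable_ignore_initial_segment)
    thus "summable (\<lambda>t. measure lborel (C t))"
    proof (rule summable_comparison_test')
      show "norm (measure lborel (C t)) \<le> 4 / 4 ^ (t + T0) + 64 * inverse (real (t + T0) ^ 2)" for t
        using B(3)[of "t + T0"] by (simp add: C_def)
    qed
  qed
  thus ?thesis
  proof (rule AE_mp, intro AE_I2 impI)
    fix x :: real
    assume "\<forall>\<^sub>F t in sequentially. x \<in> space lborel - C t" and x: "x \<in> {0..1}"
    then obtain T where T: "\<And>t. t \<ge> T \<Longrightarrow> x \<notin> C t"
      unfolding eventually_sequentially by blast
    show "\<forall>\<^sub>F t in sequentially. 16 ^ t / 2 \<le> real (card {n\<in>{1..<2 ^ m t}. dist_int (real n * x) < \<Phi> n})"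
    proof (rule eventually_sequentiallyI)
      fix t assume t: "T + T0 \<le> t"
      hence "x \<notin> B t" using T[of "t - T0"] by (simp add: C_def)
      thus "16 ^ t / 2 \<le> real (card {n\<in>{1..<2 ^ m t}. dist_int (real n * x) < \<Phi> n})"
        using B(4)[of t x] x t by simp
    qed
  qed
qed

lemma AE_lebesgue_of_AE_unit_interval:
  fixes P :: "real \<Rightarrow> bool"
  assumes AE: "AE x in lborel. x \<in> {0..1} \<longrightarrow> P x"
    and per: "\<And>x (z::int). P (x + of_int z) \<longleftrightarrow> P x"
  shows "AE x in lebesgue. P x"
proof -
  from AE obtain N where N: "N \<in> null_sets lborel" "{x. \<not> (x \<in> {0..1} \<longrightarrow> P x)} \<subseteq> N"
    by (auto simp: eventually_ae_filter)
  have neg: "negligible N" using N(1) by (simp add: negligible_iff_null_sets null_sets_completionI)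
  have "(\<Union>z::int. (+) (of_int z) ` N) \<in> null_sets lebesgue"
    using negligible_translation[OF neg]
    by (intro null_sets_UN') (auto simp: negligible_iff_null_sets[symmetric])
  moreover have "{x. \<not> P x} \<subseteq> (\<Union>z::int. (+) (of_int z) ` N)"
  proof
    fix x assume "x \<in> {x. \<not> P x}"
    hence "\<not> P (frac x)" using per[of "frac x" "\<lfloor>x\<rfloor>"] by (simp add: frac_def)
    moreover have "frac x \<in> {0..1}" using frac_lt_1[of x] by auto
    ultimately have "frac x \<in> N" using N(2) by blast
    thus "x \<in> (\<Union>z::int. (+) (of_int z) ` N)"
      by (intro UN_I[of "\<lfloor>x\<rfloor>"] image_eqI[of _ _ "frac x"]) (auto simp: frac_def)
  qed
  ultimately show ?thesis
    unfolding eventually_ae_filter_negligible negligible_iff_null_sets by blast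
qed

section \<open>Radii from the weights\<close>

text \<open>The integer part of the binary logarithm for n >= 1, with
  \<open>dyadic_log 0 = 0\<close>.\<close>

definition dyadic_log :: "nat \<Rightarrow> nat" where
  "dyadic_log n = (LEAST j. n < 2 ^ Suc j)"

lemma dyadic_log_eq:
  assumes "n \<in> {2 ^ j..<2 ^ Suc j}"
  shows "dyadic_log n = j"
  unfolding dyadic_log_def
proof (rule Least_equality)
  fix i assume "n < 2 ^ Suc i"
  hence "(2::nat) ^ j < 2 ^ Suc i" using assms by auto
  hence "j < Suc i" by (simp only: power_strict_increasing_iff one_less_numeral_iff semiring_norm)
  thus "j \<le> i" by simp
qed (use assms in auto)

lemma dyadic_block_pos: "n \<in> {2 ^ j..<2 ^ Suc j} \<Longrightarrow> 1 \<le> (n::nat)"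
  using one_le_power[of "2::nat" j] by (auto simp del: one_le_power)

lemma dyadic_blockI: "1 \<le> n \<Longrightarrow> n \<in> {2 ^ dyadic_log n..<2 ^ Suc (dyadic_log n)}"
proof -
  assume n: "1 \<le> n"
  obtain j where "2 ^ j \<le> n" "n < 2 ^ Suc j"
    using ex_power_ivl1[of 2 n] n by auto
  hence "n \<in> {2 ^ j..<2 ^ Suc j}" by simp
  thus ?thesis using dyadic_log_eq by metis
qed

text \<open>On the dyadic block of \<open>n\<close>, where \<open>\<psi> n \<ge> \<psi> (2 ^ Suc j)\<close>, this minorises
  \<open>\<psi> n / (\<Prod>i=1..d. dist_int (n * \<alpha> i - \<gamma> i))\<close>.\<close>

definition bohr_radius ::
    "nat \<Rightarrow> nat \<Rightarrow> (nat \<Rightarrow> real) \<Rightarrow> (nat \<Rightarrow> real) \<Rightarrow> (nat \<Rightarrow> real) \<Rightarrow> nat \<Rightarrow> real" where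
  "bohr_radius d s \<psi> \<gamma> \<alpha> n =
     (1 / 6 ^ d) * \<psi> (2 ^ Suc (dyadic_log n)) * bohr_weight d \<alpha> \<gamma> (dyadic_log n div s) n"

lemma bohr_radius_block:
  "n \<in> {2 ^ j..<2 ^ Suc j} \<Longrightarrow> bohr_radius d s \<psi> \<gamma> \<alpha> n =
     (1 / 6 ^ d) * \<psi> (2 ^ Suc j) * bohr_weight d \<alpha> \<gamma> (j div s) n"
  unfolding bohr_radius_def by (simp only: dyadic_log_eq)

lemma sum_bohr_radius_block:
  "(\<Sum>n\<in>{2 ^ j..<2 ^ Suc j}. bohr_radius d s \<psi> \<gamma> \<alpha> n * f n) =
     (1 / 6 ^ d) * \<psi> (2 ^ Suc j) * (\<Sum>n\<in>{2 ^ j..<2 ^ Suc j}. bohr_weight d \<alpha> \<gamma> (j div s) n * f n)"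
  unfolding sum_distrib_left
proof (intro sum.cong refl)
  fix n :: nat assume "n \<in> {2 ^ j..<2 ^ Suc j}"
  from bohr_radius_block[OF this, of d s \<psi> \<gamma> \<alpha>]
  show "bohr_radius d s \<psi> \<gamma> \<alpha> n * f n =
      (1 / 6 ^ d) * \<psi> (2 ^ Suc j) * (bohr_weight d \<alpha> \<gamma> (j div s) n * f n)"
    by (simp only: mult.assoc)
qed

text \<open>This is where \<psi> n < n^(-\<kappa>) enters. As s >= d / \<kappa>, the weight is at
  most 2^(d (j div s)) <= 2^(\<kappa> (j + 1)), which the bound on \<psi> at 2^(j + 1) compensates;
  the 1 / 2 comes from 1 / 6^d.\<close>

lemma bohr_radius_bounds:
  assumes \<psi>: "\<And>n. n \<ge> 1 \<Longrightarrow> 0 \<le> \<psi> n" "\<And>n. n \<ge> 1 \<Longrightarrow> \<psi> n < real n powr (- \<kappa>)"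
    and d: "d > 0" and \<kappa>: "\<kappa> > 0" and s: "s > 0" "real s \<ge> d / \<kappa>"
  shows "0 \<le> bohr_radius d s \<psi> \<gamma> \<alpha> n" "bohr_radius d s \<psi> \<gamma> \<alpha> n \<le> 1 / 2"
proof -
  let ?j = "dyadic_log n" and ?p = "2 ^ Suc (dyadic_log n) :: nat"
  have p1: "1 \<le> ?p" by (rule one_le_power) simp
  have \<psi>p: "0 \<le> \<psi> ?p" using \<psi>(1)[OF p1] .
  show "0 \<le> bohr_radius d s \<psi> \<gamma> \<alpha> n"
    unfolding bohr_radius_def using \<psi>p by (intro mult_nonneg_nonneg) auto
  have "real (?j div s * d) \<le> real ?j / s * d"
    unfolding of_nat_mult by (intro mult_right_mono of_nat_div_le_of_nat) simp
  also have "\<dots> \<le> real ?j / s * (\<kappa> * s)"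
    using s \<kappa> by (intro mult_left_mono) (simp_all add: field_simps)
  also have "\<dots> = \<kappa> * ?j" using s by simp
  also have "\<dots> \<le> \<kappa> * Suc ?j" using \<kappa> by simp
  finally have "(2::real) powr (real (?j div s * d)) \<le> 2 powr (\<kappa> * Suc ?j)" by (intro powr_mono) auto
  hence "(2::real) ^ (?j div s * d) \<le> 2 powr (\<kappa> * Suc ?j)" by (simp only: powr_realpow zero_less_numeral)
  hence W: "bohr_weight d \<alpha> \<gamma> (?j div s) n \<le> 2 powr (\<kappa> * Suc ?j)"
    using bohr_weight_le order.trans by blast
  have "real ?p powr (- \<kappa>) = 2 powr (- (\<kappa> * Suc ?j))"
    by (simp only: of_nat_power of_nat_numeral powr_realpow[symmetric] zero_less_numeral powr_powr)
       (simp add: mult.commute)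
  hence "\<psi> ?p \<le> 2 powr (- (\<kappa> * Suc ?j))" using \<psi>(2)[OF p1] by linarith
  hence "\<psi> ?p * bohr_weight d \<alpha> \<gamma> (?j div s) n \<le> 2 powr (- (\<kappa> * Suc ?j)) * 2 powr (\<kappa> * Suc ?j)"
    using W \<psi>p by (intro mult_mono) auto
  also have "\<dots> = 1" by (simp only: powr_add[symmetric]) simp
  finally have "(1 / 6 ^ d) * (\<psi> ?p * bohr_weight d \<alpha> \<gamma> (?j div s) n) \<le> (1 / 6 ^ d) * 1"
    by (intro mult_left_mono) auto
  also have "(1 / 6 ^ d) * 1 \<le> (1 / 2 :: real)"
    using d power_increasing[of 1 d "6::real"] by (simp add: field_simps)
  finally show "bohr_radius d s \<psi> \<gamma> \<alpha> n \<le> 1 / 2" by (simp add: bohr_radius_def mult.assoc)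
qed

lemma dist_int_less_bohr_radius_imp:
  assumes \<psi>: "\<And>n. n \<ge> 1 \<Longrightarrow> 0 \<le> \<psi> n" "antimono_on {1..} \<psi>" and n: "n \<ge> 1"
    and less: "dist_int y < bohr_radius d s \<psi> \<gamma> \<alpha> n"
  shows "(\<Prod>i=1..d. dist_int (real n * \<alpha> i - \<gamma> i)) * dist_int y < \<psi> n"
proof -
  let ?P = "\<Prod>i=1..d. dist_int (real n * \<alpha> i - \<gamma> i)" and ?p = "2 ^ Suc (dyadic_log n) :: nat"
  let ?W = "bohr_weight d \<alpha> \<gamma> (dyadic_log n div s) n"
  have p1: "1 \<le> ?p" by (rule one_le_power) simp
  have "n \<le> ?p" using dyadic_blockI[OF n] by auto
  hence le: "\<psi> ?p \<le> \<psi> n" using \<psi>(2) n p1 by (auto simp: monotone_on_def)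
  have P: "?P \<ge> 0" by (simp add: prod_nonneg)
  \<comment> \<open>The strict inequality forces a positive radius, hence a positive \<psi> at the
    end of the block, so n also counts when one of the other distances vanishes.\<close>
  have "bohr_radius d s \<psi> \<gamma> \<alpha> n > 0" using less dist_int_nonneg[of y] by linarith
  hence "\<psi> ?p \<noteq> 0" by (auto simp: bohr_radius_def)
  hence pos: "0 < \<psi> ?p" using \<psi>(1)[OF p1] by simp
  show ?thesis
  proof (cases "?P = 0")
    case True
    thus ?thesis using pos le by (simp only: mult_zero_left)
  next
    case False
    hence "0 < ?P" using P by linarith
    hence "?P * dist_int y < ?P * bohr_radius d s \<psi> \<gamma> \<alpha> n" using less by (intro mult_strict_left_mono)
    also have "\<dots> = (1 / 6 ^ d) * \<psi> ?p * (?W * ?P)" by (simp only: bohr_radius_def mult_ac)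
    also have "\<dots> \<le> (1 / 6 ^ d) * \<psi> ?p * 6 ^ d"
      using pos by (intro mult_left_mono bohr_weight_mult_dist_int_le) auto
    also have "\<dots> \<le> \<psi> n" using le by simp
    finally show ?thesis .
  qed
qed

text \<open>The value of \<psi> at 2^(j + 1) bounds \<psi> from below on block j and from above on
  block j + 1. Therefore block j + 1 of \<open>Psi_tilde\<close> is compared with block j of the
  radii.\<close>

lemma Psi_tilde_dyadic_le:
  assumes \<psi>: "\<And>n. n \<ge> 1 \<Longrightarrow> 0 \<le> \<psi> n" "antimono_on {1..} \<psi>" and j: "j \<ge> 1"
  shows "(\<Sum>n\<in>{2 ^ Suc j..<2 ^ Suc (Suc j)}. \<psi> n * ln (real n) ^ d) \<le> 2 * 3 ^ d * (2 ^ j * \<psi> (2 ^ Suc j) * real j ^ d)"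
proof -
  have p1: "1 \<le> (2::nat) ^ Suc j" by (rule one_le_power) simp
  have "(\<Sum>n\<in>{2 ^ Suc j..<2 ^ Suc (Suc j)}. \<psi> n * ln (real n) ^ d) \<le>
      real (card {2 ^ Suc j..<2 ^ Suc (Suc j) :: nat}) * (\<psi> (2 ^ Suc j) * (3 * real j) ^ d)"
  proof (intro sum_bounded_above mult_mono power_mono)
    fix n :: nat assume n: "n \<in> {2 ^ Suc j..<2 ^ Suc (Suc j)}"
    have n1: "1 \<le> n" by (rule dyadic_block_pos[OF n])
    show "\<psi> n \<le> \<psi> (2 ^ Suc j)" using \<psi>(2) n1 p1 n by (auto simp: monotone_on_def)
    show "0 \<le> ln (real n)" using n1 by simp
    have "n \<le> 2 ^ Suc (Suc j)" using n by auto
    from of_nat_mono[OF this, where 'a = real] have "real n \<le> 2 ^ Suc (Suc j)" by simp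
    hence "ln (real n) \<le> ln (2 ^ Suc (Suc j))" using n1 by (intro ln_mono) simp_all
    also have "\<dots> = real (Suc (Suc j)) * ln 2" by (rule ln_realpow)
    finally have le: "ln (real n) \<le> real (Suc (Suc j)) * ln 2" .
    have "ln 2 \<le> (1::real)" using ln_add_one_self_le_self[of "1::real"] by simp
    hence "real (Suc (Suc j)) * ln 2 \<le> real (Suc (Suc j)) * 1" by (rule mult_left_mono) simp
    also have "\<dots> \<le> 3 * real j" using j by simp
    finally show "ln (real n) \<le> 3 * real j" using le by linarith
  qed (use \<psi>(1) p1 in auto)
  also have "\<dots> = 2 * 3 ^ d * (2 ^ j * \<psi> (2 ^ Suc j) * real j ^ d)"
    by (simp add: power_mult_distrib)
  finally show ?thesis .
qed

section \<open>The lower bound\<close>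

text \<open>In C = 4 (36 s)^d, the logarithms on a block account for 2 * 3^d, the kernels for 6^d,
  and the lower bound for the weights with the rounding in j div s for 2 (2 s)^d. The further factor
  64 covers the step from one power of 16 to the next.\<close>

lemma AE_mult_count_ge_Psi_tilde:
  fixes d s A :: nat and c \<kappa> :: real and \<psi> \<gamma> \<alpha> :: "nat \<Rightarrow> real"
  assumes d: "d > 0" and \<kappa>: "\<kappa> > 0"
    and s: "s \<ge> 4 * (d + A)" "s \<ge> 8 * (A + 1) * d" "real s \<ge> d / \<kappa>"
    and lf: "linear_form_bounded d \<alpha> A c"
    and \<psi>: "\<And>n. n \<ge> 1 \<Longrightarrow> 0 \<le> \<psi> n" "antimono_on {1..} \<psi>" "\<And>n. n \<ge> 1 \<Longrightarrow> \<psi> n < real n powr (- \<kappa>)"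
    and unbounded: "\<not> bdd_above (range (Psi_tilde (Suc d) \<psi>))"
  shows "AE x in lebesgue. \<forall>\<^sub>F N in sequentially.
    1 / (256 * (36 * real s) ^ d) * Psi_tilde (Suc d) \<psi> N
      \<le> real (mult_count (Suc d) (\<gamma>(Suc d := 0)) (\<alpha>(Suc d := x)) N \<psi>)"
proof -
  have s0: "s > 0" using s(1) d by simp
  obtain j0 where lower: "\<And>j \<gamma>. j \<ge> j0 \<Longrightarrow>
      2 ^ j * real (j div s) ^ d \<le> 2 * (\<Sum>n\<in>{2 ^ j..<2 ^ Suc j}. bohr_weight d \<alpha> \<gamma> (j div s) n)"
    and divisors: "\<And>(j::nat) \<gamma> (D::nat). j \<ge> j0 \<Longrightarrow> D > 0 \<Longrightarrow> D \<le> j\<^sup>2 \<Longrightarrow>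
       (\<Sum>n\<in>{2 ^ j..<2 ^ Suc j}. bohr_weight d \<alpha> \<gamma> (j div s) n * (\<Sum>q | q dvd n \<and> q > D. 1 / real q))
         \<le> 8 / D * (\<Sum>n\<in>{2 ^ j..<2 ^ Suc j}. bohr_weight d \<alpha> \<gamma> (j div s) n)"
    using block_estimates[OF d lf s(1,2)] by blast
  define j1 where "j1 = max j0 s"
  define \<Phi> where "\<Phi> = bohr_radius d s \<psi> \<gamma> \<alpha>"
  define W where "W = (\<lambda>j. \<Sum>n\<in>{2 ^ j..<2 ^ Suc j}. bohr_weight d \<alpha> \<gamma> (j div s) n)"
  define v where "v = (\<lambda>j. \<Sum>n\<in>{2 ^ j..<2 ^ Suc j}. \<Phi> n)"
  define C where "C = 4 * (36 * real s) ^ d"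
  have C: "C > 0" using s0 by (simp add: C_def)
  have p1: "1 \<le> (2::nat) ^ i" for i by (rule one_le_power) simp
  have \<Phi>: "0 \<le> \<Phi> n" "\<Phi> n \<le> 1 / 2" for n
    unfolding \<Phi>_def using bohr_radius_bounds[OF \<psi>(1,3) d \<kappa> s0 s(3)] by auto
  have v_nonneg: "v j \<ge> 0" for j unfolding v_def using \<Phi> by (intro sum_nonneg)
  have v_eq: "v j = (1 / 6 ^ d) * \<psi> (2 ^ Suc j) * W j" for j
    using sum_bohr_radius_block[where f = "\<lambda>_. 1" and d = d and s = s and \<psi> = \<psi> and \<gamma> = \<gamma> and \<alpha> = \<alpha> and j = j]
    by (simp add: v_def \<Phi>_def W_def)

  define f where "f = (\<lambda>n::nat. \<psi> n * ln (real n) ^ d)"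
  define F where "F = (\<lambda>j. \<Sum>n\<in>{2 ^ j..<2 ^ Suc j}. f n)"
  have f_nonneg: "f n \<ge> 0" if "n \<ge> 1" for n
    using \<psi>(1)[OF that] that by (simp add: f_def)
  have F_nonneg: "F j \<ge> 0" for j
    unfolding F_def by (intro sum_nonneg f_nonneg dyadic_block_pos)
  have F_le: "F (Suc j) \<le> C * v j" if j: "j \<ge> j1" for j
  proof -
    have js: "j \<ge> j0" "j \<ge> s" using j by (auto simp: j1_def)
    have "j div s \<ge> 1" using js(2) s0 by (simp add: Suc_leI div_greater_zero_iff)
    \<comment> \<open>The remainder is below s <= s (j div s), so rounding costs a factor 2.\<close>
    have "j = s * (j div s) + j mod s" by simp
    also have "\<dots> \<le> s * (j div s) + s * 1" using s0 by (intro add_mono) (auto intro: less_imp_le)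
    also have "\<dots> \<le> s * (j div s) + s * (j div s)" using \<open>j div s \<ge> 1\<close> by (intro add_mono mult_left_mono) auto
    finally have "real j \<le> real (2 * s * (j div s))" by linarith
    hence "real j ^ d \<le> (2 * real s * real (j div s)) ^ d" by (intro power_mono) auto
    hence "2 ^ j * real j ^ d \<le> 2 ^ j * (2 * real s * real (j div s)) ^ d" by (intro mult_left_mono) auto
    also have "\<dots> = (2 * real s) ^ d * (2 ^ j * real (j div s) ^ d)" by (simp add: power_mult_distrib)
    also have "\<dots> \<le> (2 * real s) ^ d * (2 * W j)"
      using lower[OF js(1), of \<gamma>] by (intro mult_left_mono) (auto simp: W_def)
    finally have g: "2 ^ j * real j ^ d \<le> (2 * real s) ^ d * (2 * W j)" .
    have "F (Suc j) \<le> 2 * 3 ^ d * (2 ^ j * \<psi> (2 ^ Suc j) * real j ^ d)"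
      unfolding F_def f_def using js s0 by (intro Psi_tilde_dyadic_le \<psi>) auto
    also have "\<dots> = 2 * 3 ^ d * \<psi> (2 ^ Suc j) * (2 ^ j * real j ^ d)" by simp
    also have "\<dots> \<le> 2 * 3 ^ d * \<psi> (2 ^ Suc j) * ((2 * real s) ^ d * (2 * W j))"
      by (intro mult_left_mono[OF g] mult_nonneg_nonneg \<psi>(1) p1) auto
    also have "\<dots> = C * v j"
    proof -
      have "(36 * real s) ^ d = (3 * 6 * (2 * real s)) ^ d" by (rule arg_cong[where f = "\<lambda>y. y ^ d"]) simp
      hence eq: "(36 * real s) ^ d = 3 ^ d * 6 ^ d * (2 * real s) ^ d" by (simp only: power_mult_distrib)
      show ?thesis unfolding v_eq C_def eq by (simp add: field_simps)
    qed
    finally show ?thesis .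
  qed

  \<comment> \<open>K collects the blocks before the estimates start, and with them the dependence
    on \<alpha>; it is absorbed at the end since V is unbounded.\<close>
  define K where "K = (\<Sum>j\<le>j1. F j)"
  have K: "K \<ge> 0" unfolding K_def by (intro sum_nonneg F_nonneg)
  have sum_F: "(\<Sum>j<Suc M. F j) \<le> K + C * (\<Sum>j<M. v j)" for M
  proof (induction M)
    case 0
    have "F 0 \<le> K" unfolding K_def using F_nonneg by (intro member_le_sum) auto
    thus ?case by simp
  next
    case (Suc M)
    show ?case
    proof (cases "M \<ge> j1")
      case True
      thus ?thesis using Suc F_le[OF True] by (simp add: algebra_simps)
    next
      case False
      hence "(\<Sum>j<Suc (Suc M). F j) \<le> K"
        unfolding K_def using F_nonneg by (intro sum_mono2) auto
      moreover have "0 \<le> C * (\<Sum>j<Suc M. v j)" using C v_nonneg by (intro mult_nonneg_nonneg sum_nonneg) auto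
      ultimately show ?thesis by linarith
    qed
  qed
  have Psi_le: "Psi_tilde (Suc d) \<psi> N \<le> K + C * (\<Sum>j<M. v j)" if "N < 2 ^ Suc M" for N M
  proof -
    have "Psi_tilde (Suc d) \<psi> N = (\<Sum>n=1..N. f n)" by (simp add: Psi_tilde_def f_def)
    also have "\<dots> \<le> (\<Sum>n\<in>{2 ^ 0..<2 ^ Suc M}. f n)"
      using that f_nonneg by (intro sum_mono2) auto
    also have "\<dots> = (\<Sum>j<Suc M. F j)"
      unfolding F_def by (subst sum_dyadic_blocks) (simp_all only: lessThan_atLeast0 zero_le)
    also note sum_F
    finally show ?thesis .
  qed

  define V where "V = (\<lambda>M. \<Sum>j<M. v j)"
  have V_mono: "V i \<le> V j" if "i \<le> j" for i j
    unfolding V_def using that v_nonneg by (intro sum_mono2) auto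
  have V_unbounded: "\<exists>M. y \<le> V M" for y
  proof -
    obtain N where "Psi_tilde (Suc d) \<psi> N > K + C * y"
      using unbounded by (auto simp: bdd_above_def not_le)
    moreover have "N < 2 ^ Suc N" using less_exp[of N] unfolding power_Suc by linarith
    ultimately have "C * y < C * V N" using Psi_le[of N N] unfolding V_def by linarith
    thus ?thesis using C by (intro exI[of _ N]) simp
  qed
  \<comment> \<open>Minimality gives V M < 16^(t + 1) for the M just below \<open>m (Suc t)\<close>.
    With the comparison shifted by one block, a single block with a large sum of radii then does no
    harm.\<close>
  define m where "m = (\<lambda>t. LEAST M. (16::real) ^ t \<le> V M)"
  have m: "16 ^ t \<le> V (m t)" for t
    unfolding m_def using V_unbounded by (rule LeastI_ex)
  have m_less: "V M < 16 ^ t" if "M < m t" for M t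
    using that not_less_Least unfolding m_def by (meson not_le)
  have m_mono: "m i \<le> m j" if "i \<le> j" for i j
  proof -
    have "(16::real) ^ i \<le> 16 ^ j" using that by (intro power_increasing) auto
    hence "16 ^ i \<le> V (m j)" using m[of j] by linarith
    hence "(LEAST M. (16::real) ^ i \<le> V M) \<le> m j" by (rule Least_le)
    thus ?thesis by (simp only: m_def)
  qed
  define P where "P = (\<lambda>x. \<forall>\<^sub>F t in sequentially.
      16 ^ t / 2 \<le> real (card {n\<in>{1..<2 ^ m t}. dist_int (real n * x) < \<Phi> n}))"

  have "AE x in lebesgue. P x"
  proof (rule AE_lebesgue_of_AE_unit_interval)
    show "AE x in lborel. x \<in> {0..1} \<longrightarrow> P x"
      unfolding P_def
    proof (rule AE_count_ge_along_powers)
      show "16 ^ t \<le> (\<Sum>j<m t. sum \<Phi> {2 ^ j..<2 ^ Suc j})" for t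
        using m[of t] by (simp add: V_def v_def)
      show "(\<Sum>n\<in>{2 ^ j..<2 ^ Suc j}. \<Phi> n * (\<Sum>q | q dvd n \<and> q > D. 1 / real q))
          \<le> 8 / D * sum \<Phi> {2 ^ j..<2 ^ Suc j}" if jD: "j \<ge> j0" "D > 0" "D \<le> j\<^sup>2" for j D :: nat
      proof -
        have "(\<Sum>n\<in>{2 ^ j..<2 ^ Suc j}. \<Phi> n * (\<Sum>q | q dvd n \<and> q > D. 1 / real q)) =
          (1 / 6 ^ d) * \<psi> (2 ^ Suc j) * (\<Sum>n\<in>{2 ^ j..<2 ^ Suc j}.
             bohr_weight d \<alpha> \<gamma> (j div s) n * (\<Sum>q | q dvd n \<and> q > D. 1 / real q))"
          unfolding \<Phi>_def by (rule sum_bohr_radius_block)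
        also have "\<dots> \<le> (1 / 6 ^ d) * \<psi> (2 ^ Suc j) * (8 / D * W j)"
          unfolding W_def
          by (intro mult_left_mono[OF divisors[OF jD]] mult_nonneg_nonneg \<psi>(1) p1) auto
        also have "\<dots> = 8 / D * sum \<Phi> {2 ^ j..<2 ^ Suc j}"
          using v_eq[of j] by (simp only: v_def mult_ac)
        finally show ?thesis .
      qed
    qed (use \<Phi> in auto)
    show "P (x + of_int z) \<longleftrightarrow> P x" for x z
    proof -
      have "dist_int (real n * (x + of_int z)) = dist_int (real n * x)" for n
        using dist_int_add_int[of "real n * x" "int n * z"] by (simp add: distrib_left)
      thus ?thesis by (simp add: P_def)
    qed
  qed
  thus ?thesis
  proof (rule AE_mp, intro AE_I2 impI)
    fix x assume "P x"
    then obtain T where T: "\<And>t. t \<ge> T \<Longrightarrow>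
        16 ^ t / 2 \<le> real (card {n\<in>{1..<2 ^ m t}. dist_int (real n * x) < \<Phi> n})"
      unfolding P_def eventually_sequentially by blast
    obtain T1 where T1: "K / C < 16 ^ T1" using real_arch_pow[of 16 "K / C"] by auto
    define T2 where "T2 = max T T1"
    show "\<forall>\<^sub>F N in sequentially. 1 / (256 * (36 * real s) ^ d) * Psi_tilde (Suc d) \<psi> N
      \<le> real (mult_count (Suc d) (\<gamma>(Suc d := 0)) (\<alpha>(Suc d := x)) N \<psi>)"
    proof (rule eventually_sequentiallyI)
      fix N :: nat assume N: "2 ^ m T2 \<le> N"
      have ex: "\<exists>t. N < 2 ^ m t"
      proof -
        obtain t where t: "V N < 16 ^ t" using real_arch_pow[of 16 "V N"] by auto
        have "\<not> m t \<le> N" using V_mono[of "m t" N] m[of t] t by linarith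
        hence "(2::nat) ^ N < 2 ^ m t" by (intro power_strict_increasing) auto
        hence "N < 2 ^ m t" using less_exp[of N] by linarith
        thus ?thesis ..
      qed
      \<comment> \<open>With t' = t + 1 this means 2^(m t) <= N < 2^(m (t + 1)), so the count below
        2^(m t) bounds the count up to N from below.\<close>
      define t' where "t' = (LEAST t. N < 2 ^ m t)"
      have t': "N < 2 ^ m t'" unfolding t'_def using ex by (rule LeastI_ex)
      have "T2 < t'"
      proof (rule ccontr)
        assume "\<not> T2 < t'"
        hence "(2::nat) ^ m t' \<le> 2 ^ m T2" using m_mono[of t' T2] by (intro power_increasing) auto
        thus False using N t' by linarith
      qed
      then obtain t where t: "t' = Suc t" "T2 \<le> t" by (cases t') auto
      have N_ge: "2 ^ m t \<le> N"
        using not_less_Least[of t "\<lambda>t. N < 2 ^ m t"] t by (simp add: t'_def[symmetric] not_less)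
      have "(0::real) < 16 ^ Suc t" by simp
      hence "0 < V (m (Suc t))" using m[of "Suc t"] by linarith
      then obtain M where M: "m (Suc t) = Suc M" by (cases "m (Suc t)") (auto simp: V_def)
      have "Psi_tilde (Suc d) \<psi> N \<le> K + C * V M"
        using Psi_le[of N M] t' by (simp add: t M V_def)
      also have "V M \<le> 16 ^ Suc t" using m_less[of M "Suc t"] M by simp
      also have "K \<le> C * 16 ^ t"
      proof -
        have "(16::real) ^ T1 \<le> 16 ^ t" using t by (intro power_increasing) (auto simp: T2_def)
        hence "K / C \<le> 16 ^ t" using T1 by linarith
        thus ?thesis using C by (simp add: field_simps)
      qed
      finally have "Psi_tilde (Suc d) \<psi> N \<le> C * 16 ^ t + C * 16 ^ Suc t" using C by simp
      also have "\<dots> \<le> 32 * C * 16 ^ t" using C by simp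
      finally have "1 / (64 * C) * Psi_tilde (Suc d) \<psi> N \<le> 1 / (64 * C) * (32 * C * 16 ^ t)"
        using C by (intro mult_left_mono) auto
      also have "\<dots> = 16 ^ t / 2" using C by simp
      also have "\<dots> \<le> real (card {n\<in>{1..<2 ^ m t}. dist_int (real n * x) < \<Phi> n})"
        using T[of t] t by (simp add: T2_def)
      also have "\<dots> \<le> real (mult_count (Suc d) (\<gamma>(Suc d := 0)) (\<alpha>(Suc d := x)) N \<psi>)"
        unfolding mult_count_def
      proof (intro of_nat_mono card_mono subsetI)
        fix n assume "n \<in> {n\<in>{1..<2 ^ m t}. dist_int (real n * x) < \<Phi> n}"
        hence n: "1 \<le> n" "n \<le> N" "dist_int (real n * x) < bohr_radius d s \<psi> \<gamma> \<alpha> n"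
          using N_ge by (auto simp: \<Phi>_def)
        have "(\<Prod>i=1..Suc d. dist_int (real n * (\<alpha>(Suc d := x)) i - (\<gamma>(Suc d := 0)) i)) =
            (\<Prod>i=1..d. dist_int (real n * \<alpha> i - \<gamma> i)) * dist_int (real n * x)"
          by simp
        also have "\<dots> < \<psi> n" by (rule dist_int_less_bohr_radius_imp[OF \<psi>(1,2) n(1,3)])
        finally show "n \<in> {n\<in>{1..N}. (\<Prod>i=1..Suc d.
            dist_int (real n * (\<alpha>(Suc d := x)) i - (\<gamma>(Suc d := 0)) i)) < \<psi> n}"
          using n by simp
      qed simp
      finally show "1 / (256 * (36 * real s) ^ d) * Psi_tilde (Suc d) \<psi> N
          \<le> real (mult_count (Suc d) (\<gamma>(Suc d := 0)) (\<alpha>(Suc d := x)) N \<psi>)"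
        by (simp add: C_def)
    qed
  qed
qed

text \<open>The exceptional set is guaranteed to be finite only for exponents strictly above the
  supremum w. The maximum with 1 makes w' positive, and 1 lies below the bound as well; for k = 2
  the last inequality reads 0 < 1.\<close>

lemma real_exponent_between:
  assumes "k \<ge> 2" "w < exponent_bound k"
  obtains w' :: real where "w < ereal w'" "w' > 0" "(real (k - 1) - 1) * w' < real (k - 1)"
proof (cases "k = 2")
  case True
  hence "w < \<infinity>" using assms by (simp add: exponent_bound_def)
  then obtain r where r: "w < ereal r" using ereal_dense2 by blast
  show ?thesis
  proof (rule that[of "max r 1"])
    show "w < ereal (max r 1)" using r by (rule less_le_trans) simp
  qed (use True in auto)
next
  case False
  hence k: "k > 2" using assms by simp
  then obtain r where r: "w < ereal r" "r < (real k - 1) / (real k - 2)"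
    using assms(2) ereal_dense2[of w "exponent_bound k"] by (auto simp: exponent_bound_def)
  define r' where "r' = max r 1"
  have "1 < (real k - 1) / (real k - 2)" using k by (simp add: less_divide_eq)
  hence "r' < (real k - 1) / (real k - 2)" using r(2) by (simp add: r'_def)
  hence "(real k - 2) * r' < real k - 1" using k by (simp add: field_simps)
  moreover have "real (k - 1) = real k - 1" using k by (simp add: of_nat_diff)
  ultimately have "(real (k - 1) - 1) * r' < real (k - 1)" by simp
  moreover have "w < ereal r'" using r(1) by (rule less_le_trans) (simp add: r'_def)
  ultimately show ?thesis using that[of r'] by (simp add: r'_def)
qed

theorem theorem1p9:
  fixes k :: nat and w :: ereal and \<kappa> :: real
  assumes "k \<ge> 2" and "\<kappa> > 0" and "w < exponent_bound k"
  shows "\<exists>c::real. c > 0 \<and>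
    (\<forall>(\<psi> :: nat \<Rightarrow> real) (\<gamma> :: nat \<Rightarrow> real) (\<alpha> :: nat \<Rightarrow> real).
       (\<forall>n\<ge>1. 0 \<le> \<psi> n \<and> \<psi> n \<le> 1 / 2) \<longrightarrow>
       antimono_on {1..} \<psi> \<longrightarrow>
       (\<forall>n\<ge>1. \<psi> n < real n powr (- \<kappa>)) \<longrightarrow>
       \<not> bdd_above (range (Psi_tilde k \<psi>)) \<longrightarrow>
       mult_exponent (k - 1) \<alpha> = w \<longrightarrow>
       (AE x in lebesgue. \<forall>\<^sub>F N in sequentially.
          real (mult_count k (\<gamma>(k := 0)) (\<alpha>(k := x)) N \<psi>) \<ge> c * Psi_tilde k \<psi> N))"
proof -
  define d where "d = k - 1"
  have k: "k = Suc d" and d: "d \<ge> 1" using assms(1) by (auto simp: d_def)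
  obtain w' where w': "w < ereal w'" "w' > 0" "(real d - 1) * w' < real d"
    using real_exponent_between[OF assms(1,3)] unfolding d_def by metis
  obtain A :: nat where A:
    "\<And>\<alpha>. finite {n::nat. n \<ge> 1 \<and> (\<Prod>i=1..d. dist_int (real n * \<alpha> i)) < real n powr (- w')} \<Longrightarrow>
      \<exists>c. linear_form_bounded d \<alpha> A c"
    using linear_form_bound[OF d w'(2,3)] by blast
  \<comment> \<open>A sum meets all three lower bounds at once. Besides k it depends only on
    \<kappa> and, through w' and A, on w, and so does the final constant.\<close>
  define s where "s = 4 * (d + A) + 8 * (A + 1) * d + nat \<lceil>d / \<kappa>\<rceil>"
  have "d / \<kappa> \<le> real (nat \<lceil>d / \<kappa>\<rceil>)" by linarith
  also have "\<dots> \<le> real s" by (simp only: s_def of_nat_le_iff)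
  finally have s: "s \<ge> 4 * (d + A)" "s \<ge> 8 * (A + 1) * d" "real s \<ge> d / \<kappa>" by (auto simp: s_def)
  have s0: "s > 0" using s(1) d by simp
  show ?thesis
  proof (intro exI[of _ "1 / (256 * (36 * real s) ^ d)"] conjI allI impI)
    show "0 < 1 / (256 * (36 * real s) ^ d)" using s0 by simp
    fix \<psi> \<gamma> \<alpha> :: "nat \<Rightarrow> real"
    assume \<psi>: "\<forall>n\<ge>1. 0 \<le> \<psi> n \<and> \<psi> n \<le> 1 / 2" "antimono_on {1..} \<psi>" "\<forall>n\<ge>1. \<psi> n < real n powr (- \<kappa>)"
      and unbounded: "\<not> bdd_above (range (Psi_tilde k \<psi>))" and exponent: "mult_exponent (k - 1) \<alpha> = w"
    have "finite {n::nat. n \<ge> 1 \<and> (\<Prod>i=1..d. dist_int (real n * \<alpha> i)) < real n powr (- w')}"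
    proof (rule ccontr)
      assume "infinite {n::nat. n \<ge> 1 \<and> (\<Prod>i=1..d. dist_int (real n * \<alpha> i)) < real n powr (- w')}"
      hence "ereal w' \<le> mult_exponent d \<alpha>"
        unfolding mult_exponent_def by (intro Sup_upper) blast
      thus False using exponent w'(1) by (simp add: k)
    qed
    from A[OF this] obtain c where "linear_form_bounded d \<alpha> A c" ..
    thus "AE x in lebesgue. \<forall>\<^sub>F N in sequentially.
        1 / (256 * (36 * real s) ^ d) * Psi_tilde k \<psi> N \<le> real (mult_count k (\<gamma>(k := 0)) (\<alpha>(k := x)) N \<psi>)"
      unfolding k using \<psi> unbounded d assms(2) s
      by (intro AE_mult_count_ge_Psi_tilde[where A = A and c = c and \<kappa> = \<kappa>]) (auto simp: k)
  qed
qed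

end
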